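(* Let $\tau=231$. Let $\{X_n\}_{n=1}^\infty$ and $\{\Pi_I^{231}\}_I$ (indexed by finite blocks $I\subset\mathbb{N}$) be mutually independent random variables, where the $X_n$ are IID with $P(X_n=k)=\frac{C_k}{2\cdot 4^k}$, $k=0,1,2,\dots$, and each $\Pi_I^{231}$ is uniformly distributed over the $231$-avoiding permutation images of $I$. Let $T_0^X=0$ and $T_n^X=\sum_{j=1}^nX_j$. Then, as $n\to\infty$, $\mu_n^{231}$ converges weakly, as probability measures on $S(\mathbb{N},\mathbb{N}^* )$, to the distribution of the random variable $$\ast_{n=1}^\infty\Big(\Pi^{231}_{[T_{n-1}^X+1,\,T_n^X]}*\infty^{(1)}\Big)=\Pi^{231}_{[1,T_1^X]}*\infty^{(1)}*\Pi^{231}_{[T_1^X+1,\,T_2^X]}*\infty^{(1)}*\cdots,$$ which takes values (almost surely) in $S_{\text{sur}}(\mathbb{N},\mathbb{N}^* )$.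
   Context: $\mathbb{N}=\{1,2,\dots\}$ and $[n]=\{1,\dots,n\}$. $C_n=\frac{1}{n+1}\binom{2n}{n}$ is the $n$th Catalan number. $S_n$ is the set of permutations of $[n]$. For $\tau=\tau_1\cdots\tau_m\in S_m$, a finite sequence of distinct integers $\sigma_1,\dots,\sigma_l$ contains $\tau$ if there are indices $i_1<\cdots<i_m$ such that for all $1\le j,k\le m$, $\sigma_{i_j}<\sigma_{i_k}$ if and only if $\tau_j<\tau_k$; otherwise it avoids $\tau$. $S_n(\tau)$ is the set of $\tau$-avoiding permutations in $S_n$, and $\mu_n^\tau$ is the uniform probability measure on $S_n(\tau)$. $\mathbb{N}^*=\mathbb{N}\cup\{\infty\}$ carries the metric $d_{\mathbb{N}^*}(i,j)=\sum_{k=i}^{j-1}2^{-k}$ for $1\le i<j\le\infty$. $S(\mathbb{N},\mathbb{N}^* )$ is the set of functions $\sigma=\{\sigma_i\}_{i=1}^\infty$ from $\mathbb{N}$ to $\mathbb{N}^*$ that are injective on $\sigma^{-1}(\mathbb{N})$, with the metric $D(\sigma,\rho)=\sum_{i=1}^\infty 2^{-i}d_{\mathbb{N}^*}(\sigma_i,\rho_i)$; it is a compact metric space. $S_{\text{sur}}(\mathbb{N},\mathbb{N}^* )\subset S(\mathbb{N},\mathbb{N}^* )$ is the subset of surjections from $\mathbb{N}$ onto $\mathbb{N}^*$. $S_n$ is regarded as a subset of $S(\mathbb{N},\mathbb{N}^* )$ by setting $\sigma_j=j$ for $j>n$, so $\mu_n^\tau$ is a probability measure on $S(\mathbb{N},\mathbb{N}^*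 )$. A block is a set of consecutive integers $[a,b]=\{a,\dots,b\}\subset\mathbb{N}$; $[a,a-1]=\emptyset$. A permutation image of a finite set $I\subset\mathbb{N}$ is a listing $(i_1\ i_2\cdots i_{|I|})$ of all the elements of $I$ in some order, each exactly once (the empty listing if $I=\emptyset$); it is $\tau$-avoiding if this sequence avoids $\tau$. $\infty^{(1)}$ denotes the one-term listing $(\infty)$. The symbol $*$ denotes concatenation of listings: an infinite concatenation of finite listings is read, from left to right, as the sequence of values $\sigma_1,\sigma_2,\sigma_3,\dots$ of a function $\sigma$ on $\mathbb{N}$. *)

theory Defs
  imports "HOL-Probability.Probability" "HOL-Combinatorics.Multiset_Permutations"
begin

section \<open>Pattern avoidance\<close>

text \<open>Permutations used as patterns, and finite sequences in general, are lists
  (0-based positions), for example \<open>[2,3,1]\<close> for 231.\<close>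

definition contains_pattern :: "nat list \<Rightarrow> nat list \<Rightarrow> bool" where
  "contains_pattern \<tau> s \<longleftrightarrow>
     (\<exists>i :: nat \<Rightarrow> nat. strict_mono_on {..<length \<tau>} i \<and> i ` {..<length \<tau>} \<subseteq> {..<length s} \<and>
        (\<forall>j<length \<tau>. \<forall>k<length \<tau>. s ! (i j) < s ! (i k) \<longleftrightarrow> \<tau> ! j < \<tau> ! k))"

definition avoids :: "nat list \<Rightarrow> nat list \<Rightarrow> bool" where
  "avoids \<tau> s \<longleftrightarrow> \<not> contains_pattern \<tau> s"

definition avoiding_perms :: "nat list \<Rightarrow> nat \<Rightarrow> (nat \<Rightarrow> nat) set" where
  "avoiding_perms \<tau> n = {p. p permutes {1..n} \<and> avoids \<tau> (map p [1..<Suc n])}"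

definition avoiding_images :: "nat list \<Rightarrow> nat set \<Rightarrow> nat list set" where
  "avoiding_images \<tau> I = {xs \<in> permutations_of_set I. avoids \<tau> xs}"

text \<open>The empty block is included, as \<open>{a..b}\<close> with \<open>b < a\<close>.\<close>

definition blocks :: "nat set set" where
  "blocks = {{a..b} | a b. 1 \<le> a}"

definition catalan :: "nat \<Rightarrow> real" where
  "catalan n = real ((2 * n) choose n) / real (n + 1)"


section \<open>The metric spaces of extended naturals and of sequences\<close>

definition Nstar :: "enat set" where
  "Nstar = {1..}"

text \<open>For \<open>i < j\<close> the index set is \<open>{i..<j}\<close>; the use of \<open>min\<close> and \<open>max\<close> makes the
  function symmetric, and it vanishes for \<open>i = j\<close>.\<close>

definition dist_Nstar :: "enat \<Rightarrow> enat \<Rightarrow> real" where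
  "dist_Nstar i j = (\<Sum>\<^sub>\<infinity>k\<in>{k :: nat. min i j \<le> enat k \<and> enat k < max i j}. (1/2) ^ k)"

text \<open>Sequences are indexed by \<open>{1..}\<close> and are \<open>undefined\<close> at index 0.\<close>

definition seq_space :: "(nat \<Rightarrow> enat) set" where
  "seq_space = {\<sigma> \<in> {1..} \<rightarrow>\<^sub>E Nstar. inj_on \<sigma> {i \<in> {1..}. \<sigma> i \<noteq> \<infinity>}}"

definition dist_seq :: "(nat \<Rightarrow> enat) \<Rightarrow> (nat \<Rightarrow> enat) \<Rightarrow> real" where
  "dist_seq \<sigma> \<rho> = (\<Sum>\<^sub>\<infinity>i\<in>{1..}. (1/2) ^ i * dist_Nstar (\<sigma> i) (\<rho> i))"

definition sur_seq_space :: "(nat \<Rightarrow> enat) set" where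
  "sur_seq_space = {\<sigma> \<in> seq_space. \<sigma> ` {1..} = Nstar}"

lemma summable_half: "(\<lambda>k::nat. (1/2::real) ^ k) summable_on A"
proof -
  have "(\<lambda>k::nat. (1/2::real) ^ k) summable_on UNIV"
    by (subst summable_on_UNIV_nonneg_real_iff) auto
  then show ?thesis
    using summable_on_subset_banach by blast
qed

definition tail_weight :: "enat \<Rightarrow> real" where
  "tail_weight i = (\<Sum>\<^sub>\<infinity>k\<in>{k :: nat. i \<le> enat k}. (1/2) ^ k)"

lemma dist_Nstar_le:
  assumes "i \<le> j"
  shows "dist_Nstar i j = tail_weight i - tail_weight j"
proof -
  have "{k. min i j \<le> enat k \<and> enat k < max i j} = {k. i \<le> enat k} - {k. j \<le> enat k}"
    using assms by (auto simp: min_def max_def)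
  then show ?thesis
    unfolding dist_Nstar_def tail_weight_def using assms
    by (simp add: infsum_Diff summable_half Collect_mono_iff order.trans[OF assms])
qed

lemma tail_weight_less:
  assumes "i < j"
  shows "tail_weight j < tail_weight i"
proof -
  obtain m where m: "i = enat m"
    using assms by (cases i) auto
  let ?A = "{k. min i j \<le> enat k \<and> enat k < max i j}"
  have "m \<in> ?A"
    using assms m by (auto simp: min_def max_def)
  then have "(1/2::real) ^ m = (\<Sum>\<^sub>\<infinity>k\<in>{m}. (1/2) ^ k)"
    by simp
  also have "\<dots> \<le> dist_Nstar i j"
    unfolding dist_Nstar_def
    by (rule infsum_mono2) (use \<open>m \<in> ?A\<close> in \<open>auto simp: summable_half\<close>)
  finally have "0 < dist_Nstar i j"
    by (smt (verit) zero_less_power half_gt_zero_iff)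
  then show ?thesis
    using dist_Nstar_le[of i j] assms by simp
qed

lemma dist_Nstar_eq: "dist_Nstar i j = \<bar>tail_weight i - tail_weight j\<bar>"
proof -
  have *: "dist_Nstar i j = \<bar>tail_weight i - tail_weight j\<bar>" if "i \<le> j" for i j
  proof (cases "i = j")
    case False
    then have "tail_weight j < tail_weight i"
      using that by (intro tail_weight_less) simp
    then show ?thesis
      using dist_Nstar_le[OF that] by linarith
  qed (simp add: dist_Nstar_le)
  have "dist_Nstar i j = dist_Nstar j i"
    by (simp add: dist_Nstar_def min.commute max.commute)
  then show ?thesis
    using *[of i j] *[of j i] by (cases "i \<le> j") auto
qed

lemma tail_weight_inj: "tail_weight i = tail_weight j \<longleftrightarrow> i = j"
  using tail_weight_less[of i j] tail_weight_less[of j i] by (cases i j rule: linorder_cases) auto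

lemma Metric_space_Nstar: "Metric_space Nstar dist_Nstar"
  by unfold_locales (auto simp: dist_Nstar_eq tail_weight_inj)

lemma dist_Nstar_bound: "dist_Nstar i j \<le> tail_weight 0"
proof -
  have "0 \<le> tail_weight k" "tail_weight k \<le> tail_weight 0" for k
    using tail_weight_less[of 0 k] by (cases "k = 0"; auto simp: tail_weight_def infsum_nonneg)+
  then show ?thesis
    unfolding dist_Nstar_eq by (smt (verit))
qed

lemma summable_dist_seq: "(\<lambda>i. (1/2) ^ i * dist_Nstar (\<sigma> i) (\<rho> i)) summable_on {1..}"
proof (rule summable_on_comparison_test)
  show "(\<lambda>i::nat. (1/2) ^ i * tail_weight 0) summable_on {1..}"
    by (intro summable_on_cmult_left summable_half)
  show "(1/2) ^ i * dist_Nstar (\<sigma> i) (\<rho> i) \<le> (1/2) ^ i * tail_weight 0" for i :: nat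
    by (intro mult_left_mono dist_Nstar_bound) simp
  show "0 \<le> (1/2) ^ i * dist_Nstar (\<sigma> i) (\<rho> i)" for i :: nat
    by (simp add: dist_Nstar_eq)
qed

lemma Metric_space_seq_space: "Metric_space seq_space dist_seq"
proof
  show "0 \<le> dist_seq \<sigma> \<rho>" for \<sigma> \<rho>
    unfolding dist_seq_def by (intro infsum_nonneg) (simp add: dist_Nstar_eq)
  show "dist_seq \<sigma> \<rho> = dist_seq \<rho> \<sigma>" for \<sigma> \<rho>
    unfolding dist_seq_def by (simp add: dist_Nstar_eq abs_minus_commute)
next
  fix \<sigma> \<rho> assume *: "\<sigma> \<in> seq_space" "\<rho> \<in> seq_space"
  show "dist_seq \<sigma> \<rho> = 0 \<longleftrightarrow> \<sigma> = \<rho>"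
  proof
    assume "dist_seq \<sigma> \<rho> = 0"
    then have "(1/2) ^ i * dist_Nstar (\<sigma> i) (\<rho> i) = 0" if "i \<in> {1..}" for i
      using nonneg_infsum_le_0D[OF _ summable_dist_seq[of \<sigma> \<rho>]] that
      by (force simp: dist_seq_def dist_Nstar_eq)
    then have "\<sigma> i = \<rho> i" if "i \<in> {1..}" for i
      using that by (force simp: dist_Nstar_eq tail_weight_inj)
    then show "\<sigma> = \<rho>"
      using * by (intro PiE_ext[of \<sigma> "{1..}" "\<lambda>_. Nstar" \<rho>]) (auto simp: seq_space_def)
  qed (simp add: dist_seq_def dist_Nstar_eq)
next
  fix \<sigma> \<rho> \<pi>
  have "dist_seq \<sigma> \<pi> \<le>
      (\<Sum>\<^sub>\<infinity>i\<in>{1..}. (1/2) ^ i * dist_Nstar (\<sigma> i) (\<rho> i) + (1/2) ^ i * dist_Nstar (\<rho> i) (\<pi> i))"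
    unfolding dist_seq_def
  proof (intro infsum_mono summable_dist_seq summable_on_add)
    fix i :: nat
    have "dist_Nstar (\<sigma> i) (\<pi> i) \<le> dist_Nstar (\<sigma> i) (\<rho> i) + dist_Nstar (\<rho> i) (\<pi> i)"
      by (simp add: dist_Nstar_eq)
    then have "(1/2) ^ i * dist_Nstar (\<sigma> i) (\<pi> i)
        \<le> (1/2) ^ i * (dist_Nstar (\<sigma> i) (\<rho> i) + dist_Nstar (\<rho> i) (\<pi> i))"
      by (intro mult_left_mono) auto
    then show "(1/2) ^ i * dist_Nstar (\<sigma> i) (\<pi> i)
        \<le> (1/2) ^ i * dist_Nstar (\<sigma> i) (\<rho> i) + (1/2) ^ i * dist_Nstar (\<rho> i) (\<pi> i)"
      by (simp add: distrib_left)
  qed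
  also have "\<dots> = dist_seq \<sigma> \<rho> + dist_seq \<rho> \<pi>"
    unfolding dist_seq_def by (intro infsum_add summable_dist_seq)
  finally show "dist_seq \<sigma> \<pi> \<le> dist_seq \<sigma> \<rho> + dist_seq \<rho> \<pi>" .
qed

definition seq_topology :: "(nat \<Rightarrow> enat) topology" where
  "seq_topology = Metric_space.mtopology seq_space dist_seq"

lemma topspace_seq_topology: "topspace seq_topology = seq_space"
  by (simp add: seq_topology_def Metric_space.topspace_mtopology[OF Metric_space_seq_space])


section \<open>Weak convergence of Borel probability measures on a topological space\<close>

definition borel_sigma :: "'a topology \<Rightarrow> 'a measure" where
  "borel_sigma T = sigma (topspace T) {U. openin T U}"

definition prob_measures_on :: "'a topology \<Rightarrow> 'a measure set" where
  "prob_measures_on T = {\<mu>. prob_space \<mu> \<and> sets \<mu> = sets (borel_sigma T)}"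

definition converges_weakly :: "'a topology \<Rightarrow> (nat \<Rightarrow> 'a measure) \<Rightarrow> 'a measure \<Rightarrow> bool" where
  "converges_weakly T \<mu>s \<mu> \<longleftrightarrow>
     (\<forall>n. \<mu>s n \<in> prob_measures_on T) \<and> \<mu> \<in> prob_measures_on T \<and>
     (\<forall>f :: 'a \<Rightarrow> real. continuous_map T euclideanreal f \<and> bounded (f ` topspace T) \<longrightarrow>
        (\<lambda>n. \<integral>x. f x \<partial>\<mu>s n) \<longlonglongrightarrow> (\<integral>x. f x \<partial>\<mu>))"


section \<open>The measures and the limiting random sequence\<close>

text \<open>If \<open>p permutes {1..n}\<close> then \<open>p j = j\<close> for all \<open>j > n\<close>.\<close>

definition perm_to_seq :: "(nat \<Rightarrow> nat) \<Rightarrow> nat \<Rightarrow> enat" where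
  "perm_to_seq p = restrict (\<lambda>j. enat (p j)) {1..}"

definition uniform_avoiding :: "nat list \<Rightarrow> nat \<Rightarrow> (nat \<Rightarrow> enat) measure" where
  "uniform_avoiding \<tau> n =
     distr (uniform_count_measure (avoiding_perms \<tau> n)) (borel_sigma seq_topology) perm_to_seq"

text \<open>\<open>inf_concat L\<close> is the concatenation of \<open>L 1, L 2, \<dots>\<close>: its value at position \<open>j \<ge> 1\<close>
  is the \<open>j\<close>-th entry of any finite concatenation of \<open>L 1, \<dots>, L N\<close> that has at least
  \<open>j\<close> entries.\<close>

definition inf_concat :: "(nat \<Rightarrow> 'a list) \<Rightarrow> nat \<Rightarrow> 'a" where
  "inf_concat L = restrict
     (\<lambda>j. let N = (LEAST N. j \<le> length (concat (map L [1..<Suc N])))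
          in concat (map L [1..<Suc N]) ! (j - 1)) {1..}"

definition partial_sum :: "(nat \<Rightarrow> 'w \<Rightarrow> nat) \<Rightarrow> nat \<Rightarrow> 'w \<Rightarrow> nat" where
  "partial_sum X n \<omega> = (\<Sum>j=1..n. X j \<omega>)"

definition random_concat ::
  "(nat \<Rightarrow> 'w \<Rightarrow> nat) \<Rightarrow> (nat set \<Rightarrow> 'w \<Rightarrow> nat list) \<Rightarrow> 'w \<Rightarrow> nat \<Rightarrow> enat" where
  "random_concat X R \<omega> = inf_concat
     (\<lambda>n. map enat (R {partial_sum X (n - 1) \<omega> + 1 .. partial_sum X n \<omega>} \<omega>) @ [\<infinity>])"

text \<open>\<open>indep_vars\<close> needs a common value type, so the two families are joined into one by
  means of sum types, both for the indices and for the values.\<close>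

definition joint_family ::
  "(nat \<Rightarrow> 'w \<Rightarrow> nat) \<Rightarrow> (nat set \<Rightarrow> 'w \<Rightarrow> nat list) \<Rightarrow> nat + nat set \<Rightarrow> 'w \<Rightarrow> nat + nat list" where
  "joint_family X R i \<omega> = (case i of Inl n \<Rightarrow> Inl (X n \<omega>) | Inr I \<Rightarrow> Inr (R I \<omega>))"

end

theory Submission
  imports Defs "HOL-Real_Asymp.Real_Asymp"
begin

text \<open>The first entry \<open>s\<close> of a 231-avoiding word splits the rest into a 231-avoiding word on the
  smaller values followed by one on the larger values. This gives the Catalan recurrence, and,
  since \<open>C\<^bsub>n-j\<^esub> / C\<^sub>n\<close> tends to \<open>4\<^bsup>-j\<^esup>\<close>, it shows that the first entry is asymptotically either
  bounded or at bounded distance from \<open>n\<close>. By induction on the number of blocks, the probability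
  that a random permutation starts with given avoiding words on consecutive blocks of total
  length \<open>T\<close>, each followed by a large value, is asymptotically at least the product \<open>2\<^bsup>-m\<^esup> 4\<^bsup>-T\<^esup>\<close>
  over the \<open>m\<close> blocks. This is exactly the probability that the limit starts with these blocks
  followed by \<open>\<infinity>\<close>. For fixed \<open>m\<close> these probabilities add up to 1, so lower bounds suffice for
  weak convergence, as in the portmanteau theorem: a continuous \<open>f \<ge> 0\<close> is approximated from
  below by its infima over the corresponding cylinder sets.\<close>


section \<open>Catalan numbers\<close>

lemma catalan_0 [simp]: "catalan 0 = 1"
  by (simp add: catalan_def)

lemma catalan_pos: "0 < catalan n"
  by (simp add: catalan_def)

lemma catalan_Suc: "real (n + 2) * catalan (Suc n) = 2 * (2 * real n + 1) * catalan n"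
proof -
  have "fact (2 * Suc n) = (2 * real n + 2) * (2 * real n + 1) * (fact (2 * n) :: real)"
    by (simp add: algebra_simps)
  moreover have "2 * Suc n - Suc n = Suc n" "2 * n - n = n"
    by auto
  ultimately have "catalan (Suc n) = (2 * real n + 2) * (2 * real n + 1) * fact (2 * n)
      / ((1 + real n) * fact n * ((1 + real n) * fact n) * (2 + real n))"
      "catalan n = fact (2 * n) / (fact n * fact n * (1 + real n))"
    by (simp_all add: catalan_def binomial_fact del: mult_Suc_right)
  \<comment> \<open>The cancellation is carried out for abstract \<open>f\<close>, \<open>F\<close>
    and \<open>x\<close>, so that the factorials enter as opaque terms and are not unfolded a second
    time.\<close>
  moreover have "(2 + x) * ((2 * x + 2) * (2 * x + 1) * F / ((1 + x) * f * ((1 + x) * f) * (2 + x)))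
      = 2 * (2 * x + 1) * (F / (f * f * (1 + x)))" if "f \<noteq> 0" "1 + x \<noteq> 0" "2 + x \<noteq> 0" for f F x :: real
    using that by (simp add: divide_simps) algebra
  from this[of "fact n" "real n" "fact (2 * n)"]
  have "(2 + real n) * ((2 * real n + 2) * (2 * real n + 1) * fact (2 * n)
        / ((1 + real n) * fact n * ((1 + real n) * fact n) * (2 + real n)))
      = 2 * (2 * real n + 1) * (fact (2 * n) / (fact n * fact n * (1 + real n)))"
    by simp
  ultimately show ?thesis
    by (simp only: of_nat_add of_nat_numeral add.commute[of "real n" 2])
qed

text \<open>The generating function of the Catalan numbers is (1 - sqrt (1 - 4x)) / (2x), so up to a
  shift and a scaling they are the binomial coefficients of exponent 1/2. The proof compares the
  two-term recurrences of both sides.\<close>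

lemma catalan_gbinomial: "catalan n = 2 * (-4) ^ n * ((1/2::real) gchoose Suc n)"
proof (induction n)
  case (Suc n)
  have "(1/2::real) * (1/2 gchoose Suc n)
      = of_nat (Suc n) * (1/2 gchoose Suc n) + of_nat (Suc (Suc n)) * (1/2 gchoose Suc (Suc n))"
    by (rule gbinomial_mult_1)
  then have *: "real (n + 2) * (1/2 gchoose Suc (Suc n)) = - (real n + 1/2) * (1/2 gchoose Suc n)"
    by (simp add: algebra_simps)
  have "real (n + 2) * catalan (Suc n) = 2 * (2 * real n + 1) * (2 * (-4) ^ n * (1/2 gchoose Suc n))"
    by (subst catalan_Suc) (simp only: Suc.IH)
  also have "\<dots> = 2 * (-4) ^ Suc n * (- (real n + 1/2) * (1/2 gchoose Suc n))"
    by (simp add: algebra_simps)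
  also have "\<dots> = 2 * (-4) ^ Suc n * (real (n + 2) * (1/2 gchoose Suc (Suc n)))"
    by (simp only: *)
  also have "\<dots> = real (n + 2) * (2 * (-4) ^ Suc n * (1/2 gchoose Suc (Suc n)))"
    by (simp only: ac_simps)
  finally show ?case
    by (simp only: mult_cancel_left) simp
qed simp

text \<open>This is the Vandermonde convolution of \<open>1/2\<close> with itself, as \<open>1 gchoose n\<close> vanishes for
  \<open>n \<ge> 2\<close>; the two boundary terms give the right-hand side.\<close>

lemma catalan_convolution: "(\<Sum>i\<le>n. catalan i * catalan (n - i)) = catalan (Suc n)"
proof -
  let ?a = "\<lambda>k. (1/2::real) gchoose k"
  have "(1::real) gchoose Suc (Suc n) = of_nat 1 gchoose Suc (Suc n)"
    by simp
  also have "\<dots> = of_nat (1 choose Suc (Suc n))"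
    by (simp only: binomial_gbinomial)
  finally have "(\<Sum>k=0..Suc (Suc n). ?a k * ?a (Suc (Suc n) - k)) = 0"
    by (subst gbinomial_Vandermonde) simp
  also have "(\<Sum>k=0..Suc (Suc n). ?a k * ?a (Suc (Suc n) - k))
      = 2 * ?a (Suc (Suc n)) + (\<Sum>k\<le>n. ?a (Suc k) * ?a (Suc n - k))"
    by (simp only: atMost_atLeast0[symmetric] sum.atMost_Suc_shift[of _ "Suc n"])
       (simp add: algebra_simps)
  finally have *: "(\<Sum>k\<le>n. ?a (Suc k) * ?a (Suc n - k)) = - 2 * ?a (Suc (Suc n))"
    by simp
  have "(\<Sum>i\<le>n. catalan i * catalan (n - i))
      = (\<Sum>i\<le>n. 4 * (-4) ^ n * (?a (Suc i) * ?a (Suc n - i)))"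
  proof (rule sum.cong)
    fix i assume "i \<in> {..n}"
    then have "(-4::real) ^ n = (-4) ^ i * (-4) ^ (n - i)" "Suc n - i = Suc (n - i)"
      by (auto simp flip: power_add)
    then show "catalan i * catalan (n - i) = 4 * (-4) ^ n * (?a (Suc i) * ?a (Suc n - i))"
      by (simp add: catalan_gbinomial)
  qed simp
  also have "\<dots> = catalan (Suc n)"
    by (simp only: sum_distrib_left[symmetric] *) (simp add: catalan_gbinomial)
  finally show ?thesis .
qed

lemma catalan_ratio: "(\<lambda>n. catalan (Suc n) / catalan n) \<longlonglongrightarrow> 4"
proof -
  have "catalan (Suc n) / catalan n = 2 * (2 * real n + 1) / (real n + 2)" for n
    using catalan_Suc[of n] catalan_pos[of n] by (simp add: field_simps)
  moreover have "(\<lambda>n. 2 * (2 * real n + 1) / (real n + 2)) \<longlonglongrightarrow> 4"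
    by real_asymp
  ultimately show ?thesis
    by simp
qed

lemma catalan_ratio_shift: "(\<lambda>n. catalan (n - j) / catalan n) \<longlonglongrightarrow> 1 / 4 ^ j"
\<comment> \<open>Replacing \<open>n\<close> by \<open>n + j\<close> removes the truncated
  subtraction. Each induction step then divides by one more consecutive ratio, whose limit is
  4.\<close>
proof (rule LIMSEQ_offset[of _ j])
  show "(\<lambda>n. catalan (n + j - j) / catalan (n + j)) \<longlonglongrightarrow> 1 / 4 ^ j"
  proof (induction j)
    case 0
    have "catalan n \<noteq> 0" for n
      using catalan_pos[of n] by simp
    then show ?case
      by simp
  next
    case (Suc j)
    have "(\<lambda>n. catalan (Suc (n + j)) / catalan (n + j)) \<longlonglongrightarrow> 4"
      using LIMSEQ_ignore_initial_segment[OF catalan_ratio, of j] by simp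
    from tendsto_divide[OF Suc this]
    have "(\<lambda>n. catalan n / catalan (n + j) / (catalan (Suc (n + j)) / catalan (n + j)))
        \<longlonglongrightarrow> 1 / 4 ^ j / 4"
      by simp
    moreover have "catalan n / catalan (n + j) / (catalan (Suc (n + j)) / catalan (n + j))
        = catalan n / catalan (Suc (n + j))" for n
      using catalan_pos[of "n + j"] by simp
    ultimately show ?case
      by (simp only:) (simp add: mult.commute)
  qed
qed


section \<open>231-avoiding words on a block\<close>

text \<open>The head is tested in the role of the 2: no larger entry may be followed by a smaller
  one. Because of \<open>x \<le> z\<close> instead of \<open>x < z\<close>, the test agrees with
  pattern avoidance also for words with repeated entries.\<close>

fun av231 :: "nat list \<Rightarrow> bool" where
  "av231 [] = True"
| "av231 (x # xs) = (sorted_wrt (\<lambda>y z. x < y \<longrightarrow> x \<le> z) xs \<and> av231 xs)"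

lemma av231_iff_nth:
  "av231 xs \<longleftrightarrow> (\<forall>i j k. i < j \<longrightarrow> j < k \<longrightarrow> k < length xs \<longrightarrow> \<not> (xs ! k < xs ! i \<and> xs ! i < xs ! j))"
proof (induction xs)
  case (Cons x xs)
  let ?P = "\<lambda>xs i j k. i < j \<longrightarrow> j < k \<longrightarrow> k < length xs \<longrightarrow> \<not> (xs ! k < xs ! i \<and> xs ! i < xs ! j)"
  \<comment> \<open>Triples are split by whether the first index is 0; the other two indices are
    positive in either case.\<close>
  have "(\<forall>i j k. ?P (x # xs) i j k)
      \<longleftrightarrow> (\<forall>j k. ?P (x # xs) 0 (Suc j) (Suc k)) \<and> (\<forall>i j k. ?P (x # xs) (Suc i) (Suc j) (Suc k))"
  proof (intro iffI allI)
    fix i j k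
    assume *: "(\<forall>j k. ?P (x # xs) 0 (Suc j) (Suc k)) \<and> (\<forall>i j k. ?P (x # xs) (Suc i) (Suc j) (Suc k))"
    show "?P (x # xs) i j k"
      using * by (cases i; cases j; cases k) blast+
  qed blast
  then show ?case
    unfolding av231.simps Cons.IH by (simp add: sorted_wrt_iff_nth_less) (meson not_le)
qed simp

lemma avoids_231_iff: "avoids [2,3,1] xs \<longleftrightarrow> av231 xs"
proof -
  have "contains_pattern [2,3,1] xs
      \<longleftrightarrow> (\<exists>i j k. i < j \<and> j < k \<and> k < length xs \<and> xs ! k < xs ! i \<and> xs ! i < xs ! j)"
    (is "?L \<longleftrightarrow> ?R")
  proof
    assume ?L
    moreover have "length [2,3,1::nat] = 3"
      by simp
    ultimately obtain f where f: "strict_mono_on {..<3::nat} f" "f ` {..<3} \<subseteq> {..<length xs}"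
      and iff: "\<And>j k. j < 3 \<Longrightarrow> k < 3 \<Longrightarrow> xs ! f j < xs ! f k \<longleftrightarrow> [2,3,1::nat] ! j < [2,3,1] ! k"
      unfolding contains_pattern_def by metis
    have "f 0 < f 1" "f 1 < f 2"
      using f(1) by (auto simp: strict_mono_on_def)
    moreover have "f 2 < length xs"
      using f(2) by (auto simp: image_subset_iff)
    moreover have "xs ! f 2 < xs ! f 0" "xs ! f 0 < xs ! f 1"
      using iff[of 2 0] iff[of 0 1] by (auto simp: numeral_2_eq_2)
    ultimately show ?R
      by blast
  next
    assume ?R
    then obtain i j k where *: "i < j" "j < k" "k < length xs" "xs ! k < xs ! i" "xs ! i < xs ! j"
      by blast
    have set3: "{..<length [2,3,1::nat]} = {0, 1, 2}"
      by auto
    have all3: "(\<forall>j<length [2,3,1::nat]. P j) \<longleftrightarrow> P 0 \<and> P 1 \<and> P 2" for P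
      by (auto simp: numeral_3_eq_3 numeral_2_eq_2 All_less_Suc)
    show ?L
      unfolding contains_pattern_def
    proof (intro exI[of _ "\<lambda>n. if n = 0 then i else if n = 1 then j else k"] conjI)
      show "strict_mono_on {..<length [2,3,1::nat]} (\<lambda>n::nat. if n = 0 then i else if n = 1 then j else k)"
        unfolding set3 using * by (auto simp: strict_mono_on_def)
    qed (unfold set3 all3, use * in auto)
  qed
  then show ?thesis
    by (auto simp: avoids_def av231_iff_nth)
qed

text \<open>In an occurrence of 231 the last entry lies below the first, so an occurrence that
  starts in \<open>u\<close> cannot end in \<open>v\<close>.\<close>

lemma av231_append:
  assumes "\<And>x y. x \<in> set u \<Longrightarrow> y \<in> set v \<Longrightarrow> x < y"
  shows "av231 (u @ v) \<longleftrightarrow> av231 u \<and> av231 v"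
  using assms
proof (induction u)
  case (Cons x u)
  have "sorted_wrt (\<lambda>y z. x < y \<longrightarrow> x \<le> z) v"
    using Cons.prems by (intro sorted_wrt_mono_rel[OF _ sorted_wrt_true])
      (metis less_imp_le list.set_intros(1))
  moreover have "\<forall>y\<in>set u. \<forall>z\<in>set v. x < y \<longrightarrow> x \<le> z"
    using Cons.prems by (meson less_imp_le list.set_intros(1))
  ultimately show ?case
    using Cons by (auto simp: sorted_wrt_append)
qed simp

text \<open>A block is given by the offset preceding it and by its length. Offsets of consecutive
  blocks are then partial sums of lengths, and an empty block is available at every offset.\<close>

definition avoiding_block :: "nat \<Rightarrow> nat \<Rightarrow> nat list set" where
  "avoiding_block a n = avoiding_images [2,3,1] {a + 1..a + n}"

lemma mem_avoiding_block:
  "xs \<in> avoiding_block a n \<longleftrightarrow> set xs = {a + 1..a + n} \<and> distinct xs \<and> av231 xs"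
  unfolding avoiding_block_def avoiding_images_def avoids_231_iff
  by (auto simp: permutations_of_set_def)

lemma finite_avoiding_block [simp]: "finite (avoiding_block a n)"
  by (simp add: avoiding_block_def avoiding_images_def)

lemma length_avoiding_block: "xs \<in> avoiding_block a n \<Longrightarrow> length xs = n"
  using distinct_card[of xs] by (simp add: mem_avoiding_block)

lemma avoiding_block_0 [simp]: "avoiding_block a 0 = {[]}"
  by (auto simp: mem_avoiding_block)

lemma append_avoiding_block:
  assumes "u \<in> avoiding_block a k" "v \<in> avoiding_block (a + k) m"
  shows "u @ v \<in> avoiding_block a (k + m)"
proof -
  have *: "set u = {a + 1..a + k}" "set v = {a + k + 1..a + k + m}"
    using assms by (auto simp: mem_avoiding_block)
  have "av231 (u @ v)"
    using assms by (subst av231_append) (auto simp: mem_avoiding_block)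
  moreover have "{a + 1..a + k} \<union> {a + k + 1..a + k + m} = {a + 1..a + (k + m)}"
    by auto
  ultimately show ?thesis
    using assms * by (auto simp: mem_avoiding_block)
qed

text \<open>The new head could only complete a 231 as its 2, and this is excluded because all
  smaller values precede all larger ones.\<close>

lemma Cons_avoiding_block:
  assumes "u \<in> avoiding_block a k" "v \<in> avoiding_block (a + k + 1) m"
  shows "(a + k + 1) # u @ v \<in> avoiding_block a (Suc (k + m))"
proof -
  have *: "set u = {a + 1..a + k}" "set v = {a + k + 2..a + k + 1 + m}"
    using assms by (auto simp: mem_avoiding_block)
  have "sorted_wrt (\<lambda>y z. a + k + 1 < y \<longrightarrow> a + k + 1 \<le> z) u"
       "sorted_wrt (\<lambda>y z. a + k + 1 < y \<longrightarrow> a + k + 1 \<le> z) v"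
    using * by (auto intro!: sorted_wrt_mono_rel[OF _ sorted_wrt_true])
  moreover have "av231 (u @ v)"
    using assms * by (subst av231_append) (auto simp: mem_avoiding_block)
  ultimately have "av231 ((a + k + 1) # u @ v)"
    using * by (auto simp: sorted_wrt_append)
  moreover have "insert (a + k + 1) ({a + 1..a + k} \<union> {a + k + 2..a + k + 1 + m})
      = {a + 1..a + Suc (k + m)}"
    by auto
  ultimately show ?thesis
    using assms * by (auto simp: mem_avoiding_block)
qed

text \<open>The cut is placed before the first entry above \<open>s\<close>: from there on nothing
  below \<open>s\<close> may follow, and \<open>s\<close> itself does not occur.\<close>

lemma sorted_wrt_split:
  fixes s :: nat
  assumes "sorted_wrt (\<lambda>y z. s < y \<longrightarrow> s \<le> z) xs" "s \<notin> set xs"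
  obtains u v where "xs = u @ v" "\<forall>y\<in>set u. y < s" "\<forall>z\<in>set v. s < z"
proof -
  have "\<exists>u v. xs = u @ v \<and> (\<forall>y\<in>set u. y < s) \<and> (\<forall>z\<in>set v. s < z)"
    using assms
  proof (induction xs)
    case (Cons x xs)
    show ?case
    proof (cases "x < s")
      case True
      obtain u v where "xs = u @ v" "\<forall>y\<in>set u. y < s" "\<forall>z\<in>set v. s < z"
        using Cons by auto
      then show ?thesis
        using True by (intro exI[of _ "x # u"] exI[of _ v]) auto
    next
      case False
      then have "\<forall>z\<in>set (x # xs). s < z"
        using Cons.prems by (auto simp: order.strict_iff_order)
      then show ?thesis
        by (intro exI[of _ "[]"] exI[of _ "x # xs"]) auto
    qed
  qed simp
  with that show thesis
    by blast
qed

text \<open>After the head, a larger entry followed by a smaller one would complete a 231. This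
  forces all smaller values to come first, and the value of the head fixes how many there
  are.\<close>

lemma avoiding_block_Suc:
  "avoiding_block a (Suc n) =
    (\<Union>k\<in>{..n}. (\<lambda>(u, v). (a + k + 1) # u @ v) ` (avoiding_block a k \<times> avoiding_block (a + k + 1) (n - k)))"
  (is "_ = ?R")
proof (intro subset_antisym subsetI)
  fix xs assume "xs \<in> ?R"
  then obtain k u v where "k \<le> n" "u \<in> avoiding_block a k" "v \<in> avoiding_block (a + k + 1) (n - k)"
    "xs = (a + k + 1) # u @ v"
    by auto
  then show "xs \<in> avoiding_block a (Suc n)"
    using Cons_avoiding_block[of u a k v "n - k"] by simp
next
  fix xs assume xs: "xs \<in> avoiding_block a (Suc n)"
  then have "xs \<noteq> []"
    by (auto simp: mem_avoiding_block)
  then obtain s ys where s: "xs = s # ys"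
    by (cases xs) auto
  define k where "k = s - Suc a"
  have "s \<in> {a + 1..a + Suc n}"
    using xs s by (auto simp: mem_avoiding_block)
  then have k: "s = a + k + 1" "k \<le> n"
    by (auto simp: k_def)
  have "sorted_wrt (\<lambda>y z. s < y \<longrightarrow> s \<le> z) ys" "s \<notin> set ys"
    using xs s by (auto simp: mem_avoiding_block)
  then obtain u v where uv: "ys = u @ v" "\<forall>y\<in>set u. y < s" "\<forall>z\<in>set v. s < z"
    by (rule sorted_wrt_split)
  have all: "insert s (set u \<union> set v) = {a + 1..a + Suc n}"
    using xs by (auto simp: s uv mem_avoiding_block)
  \<comment> \<open>As \<open>u\<close> lies below \<open>s\<close> and \<open>v\<close> above it,
    each is recovered by cutting the full block at \<open>s\<close>.\<close>
  have "set u = insert s (set u \<union> set v) \<inter> {..<s}" "set v = insert s (set u \<union> set v) \<inter> {s<..}"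
    using uv by fastforce+
  then have "set u = {a + 1..a + Suc n} \<inter> {..<s}" "set v = {a + 1..a + Suc n} \<inter> {s<..}"
    by (metis all)+
  moreover have "{a + 1..a + Suc n} \<inter> {..<s} = {a + 1..a + k}"
      "{a + 1..a + Suc n} \<inter> {s<..} = {a + k + 2..a + Suc n}"
    using k by auto
  ultimately have "set u = {a + 1..a + k}" "set v = {a + k + 2..a + Suc n}"
    by simp_all
  moreover have "av231 u \<and> av231 v"
    using xs uv by (subst av231_append[symmetric])
      (force simp: s mem_avoiding_block intro: less_trans)+
  ultimately have "u \<in> avoiding_block a k" "v \<in> avoiding_block (a + k + 1) (n - k)"
    using xs k by (auto simp: s uv mem_avoiding_block)
  then show "xs \<in> ?R"
    using k s uv by auto
qed

text \<open>The decomposition at the head is disjoint, since the head determines \<open>k\<close>,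
  and unique, since \<open>u\<close> has length \<open>k\<close>; so it yields the Catalan
  recurrence. The offset stays arbitrary in the induction because the second factor lives on a
  shifted block.\<close>

lemma card_avoiding_block: "real (card (avoiding_block a n)) = catalan n"
proof (induction n arbitrary: a rule: less_induct)
  case (less n)
  show ?case
  proof (cases n)
    case (Suc m)
    let ?f = "\<lambda>k (u, v). (a + k + 1) # u @ v"
    let ?A = "\<lambda>k. avoiding_block a k \<times> avoiding_block (a + k + 1) (m - k)"
    have "card (avoiding_block a n) = (\<Sum>k\<le>m. card (?f k ` ?A k))"
      unfolding Suc avoiding_block_Suc
    proof (rule card_UN_disjoint)
      show "\<forall>i\<in>{..m}. \<forall>j\<in>{..m}. i \<noteq> j \<longrightarrow> ?f i ` ?A i \<inter> ?f j ` ?A j = {}"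
        by fastforce
    qed simp_all
    also have "\<dots> = (\<Sum>k\<le>m. card (avoiding_block a k) * card (avoiding_block (a + k + 1) (m - k)))"
    proof (rule sum.cong)
      fix k
      have "inj_on (?f k) (?A k)"
      proof (rule inj_onI)
        fix p q assume "p \<in> ?A k" "q \<in> ?A k" "?f k p = ?f k q"
        then show "p = q"
          using length_avoiding_block by (cases p; cases q) fastforce
      qed
      then show "card (?f k ` ?A k) = card (avoiding_block a k) * card (avoiding_block (a + k + 1) (m - k))"
        by (simp add: card_image card_cartesian_product)
    qed simp
    finally have "real (card (avoiding_block a n)) = (\<Sum>k\<le>m. catalan k * catalan (m - k))"
      using less by (simp add: Suc)
    then show ?thesis
      by (simp add: catalan_convolution Suc)
  qed simp
qed


section \<open>Words on consecutive blocks\<close>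

text \<open>Started at offset 0, such a list records the first finite blocks of the limiting
  sequence.\<close>

fun consecutive_words :: "nat \<Rightarrow> nat list list \<Rightarrow> bool" where
  "consecutive_words a [] = True"
| "consecutive_words a (l # w) =
     (l \<in> avoiding_block a (length l) \<and> consecutive_words (a + length l) w)"

lemma consecutive_words_iff_nth:
  "consecutive_words a w \<longleftrightarrow>
     (\<forall>i<length w. w ! i \<in> avoiding_block (a + sum_list (map length (take i w))) (length (w ! i)))"
proof (induction w arbitrary: a)
  case (Cons l w)
  show ?case
    unfolding consecutive_words.simps Cons.IH length_Cons All_less_Suc2
    by (simp add: add.assoc)
qed simp

fun with_infinities :: "nat list list \<Rightarrow> enat list" where
  "with_infinities [] = []"
| "with_infinities (l # w) = map enat l @ \<infinity> # with_infinities w"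

lemma with_infinities_eqD:
  assumes "length w = length w'" "with_infinities w @ r = with_infinities w' @ r'"
  shows "w = w'"
  using assms
proof (induction w w' rule: list_induct2)
  case (Cons l w l' w')
  have *: "takeWhile (\<lambda>x. x \<noteq> \<infinity>) (with_infinities (l # w) @ r) = map enat l" for l w r
    by (induction l) auto
  have "map enat l = map enat l'"
    using *[of l w r] *[of l' w' r'] Cons.prems by simp
  then have "l = l'"
    by (simp add: inj_map_eq_map inj_def)
  then show ?case
    using Cons by simp
qed simp

lemma length_le_with_infinities: "length w \<le> length (with_infinities w)"
  by (induction w) auto

text \<open>This is the probability that the limit starts with the words \<open>w\<close>: a length
  \<open>k\<close> has probability \<open>catalan k / (2 * 4 ^ k)\<close>, the word then has
  probability \<open>1 / catalan k\<close>, and the Catalan numbers cancel.\<close>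

definition word_prob :: "nat list list \<Rightarrow> real" where
  "word_prob w = (\<Prod>l\<leftarrow>w. 1 / (2 * 4 ^ length l))"

lemma word_prob_pos: "0 < word_prob w"
  by (induction w) (auto simp: word_prob_def)

text \<open>This is closeness in the extended naturals: a finite \<open>y\<close> is isolated, while
  the neighbours of \<open>\<infinity>\<close> are the large values.\<close>

definition approx :: "nat \<Rightarrow> enat \<Rightarrow> enat \<Rightarrow> bool" where
  "approx N x y \<longleftrightarrow> (if y = \<infinity> then enat N \<le> x else x = y)"

definition starts_like :: "nat \<Rightarrow> enat list \<Rightarrow> nat list \<Rightarrow> bool" where
  "starts_like N W xs \<longleftrightarrow> (\<exists>ys zs. map enat xs = ys @ zs \<and> list_all2 (approx N) ys W)"

lemma starts_like_Nil [simp]: "starts_like N [] xs"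
  by (simp add: starts_like_def)

lemma starts_like_append:
  assumes "starts_like N W v" "N \<le> s"
  shows "starts_like N (map enat l @ \<infinity> # W) (l @ s # v @ u)"
proof -
  obtain ys zs where *: "map enat v = ys @ zs" "list_all2 (approx N) ys W"
    using assms by (auto simp: starts_like_def)
  have "map enat (l @ s # v @ u) = (map enat l @ enat s # ys) @ (zs @ map enat u)"
    using * by simp
  moreover have "list_all2 (approx N) (map enat l) (map enat l)"
    by (auto simp: list_all2_same approx_def)
  then have "list_all2 (approx N) (map enat l @ enat s # ys) (map enat l @ \<infinity> # W)"
    using * assms by (intro list_all2_appendI) (auto simp: approx_def)
  ultimately show ?thesis
    unfolding starts_like_def by blast
qed

section \<open>Asymptotic count of the avoiding words with a prescribed beginning\<close>

definition matching_words :: "nat \<Rightarrow> nat list list \<Rightarrow> nat \<Rightarrow> nat \<Rightarrow> nat list set" where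
  "matching_words N w a n = {xs \<in> avoiding_block a n. starts_like N (with_infinities w) xs}"

lemma finite_matching_words [simp]: "finite (matching_words N w a n)"
  by (simp add: matching_words_def)

text \<open>The entry \<open>a + n - i\<close> plays the role of the first \<open>\<infinity>\<close>; the \<open>i\<close> larger values stand at
  the very end of the word, so that they do not interfere with \<open>w\<close>.\<close>

lemma card_matching_words_Cons:
  assumes l: "l \<in> avoiding_block a k" and n: "k + 1 + J + N \<le> n"
  shows "(\<Sum>i\<le>J. catalan i * real (card (matching_words N w (a + k) (n - (k + 1 + i)))))
    \<le> real (card (matching_words N (l # w) a n))"
proof -
  let ?A = "\<lambda>i. matching_words N w (a + k) (n - (k + 1 + i)) \<times> avoiding_block (a + n - i) i"
  let ?f = "\<lambda>i (v, u). l @ (a + n - i) # v @ u"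
  have "?f i (v, u) \<in> matching_words N (l # w) a n" if "i \<le> J" "(v, u) \<in> ?A i" for i v u
  proof -
    have "v \<in> avoiding_block (a + k) (n - (k + 1 + i))" "u \<in> avoiding_block (a + n - i) i"
      and like: "starts_like N (with_infinities w) v"
      using that by (auto simp: matching_words_def)
    moreover have "a + k + (n - (k + 1 + i)) + 1 = a + n - i" "Suc (n - (k + 1 + i) + i) = n - k"
      using that n by auto
    ultimately have "(a + n - i) # v @ u \<in> avoiding_block (a + k) (n - k)"
      using Cons_avoiding_block[of v "a + k" "n - (k + 1 + i)" u i] by metis
    from append_avoiding_block[OF l this] have "l @ (a + n - i) # v @ u \<in> avoiding_block a n"
      using n by simp
    \<comment> \<open>The bound on \<open>n\<close> gives \<open>N \<le> a + n - i\<close>, so that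
      this entry passes for an \<open>\<infinity>\<close>.\<close>
    moreover have "starts_like N (with_infinities (l # w)) (l @ (a + n - i) # v @ u)"
      using starts_like_append[OF like, of "a + n - i" l u] that n by simp
    ultimately show ?thesis
      by (simp add: matching_words_def)
  qed
  then have "(\<Union>i\<in>{..J}. ?f i ` ?A i) \<subseteq> matching_words N (l # w) a n"
    by blast
  then have "card (\<Union>i\<in>{..J}. ?f i ` ?A i) \<le> card (matching_words N (l # w) a n)"
    by (intro card_mono) auto
  also have "card (\<Union>i\<in>{..J}. ?f i ` ?A i) = (\<Sum>i\<le>J. card (?f i ` ?A i))"
  proof (rule card_UN_disjoint)
    \<comment> \<open>Different \<open>i\<close> put different entries right after \<open>l\<close>;
      the subtraction does not truncate because \<open>J \<le> n\<close>.\<close>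
    have "a + n - i \<noteq> a + n - j" if "i \<le> J" "j \<le> J" "i \<noteq> j" for i j
      using that n by linarith
    then show "\<forall>i\<in>{..J}. \<forall>j\<in>{..J}. i \<noteq> j \<longrightarrow> ?f i ` ?A i \<inter> ?f j ` ?A j = {}"
      by fastforce
  qed simp_all
  also have "\<dots> = (\<Sum>i\<le>J. card (avoiding_block (a + n - i) i) * card (matching_words N w (a + k) (n - (k + 1 + i))))"
  proof (rule sum.cong)
    fix i
    have "inj_on (?f i) (?A i)"
    proof (rule inj_onI)
      fix p q assume "p \<in> ?A i" "q \<in> ?A i" "?f i p = ?f i q"
      then show "p = q"
        using length_avoiding_block by (cases p; cases q) (fastforce simp: matching_words_def)
    qed
    then show "card (?f i ` ?A i)
        = card (avoiding_block (a + n - i) i) * card (matching_words N w (a + k) (n - (k + 1 + i)))"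
      by (simp add: card_image card_cartesian_product)
  qed simp
  finally have "real (\<Sum>i\<le>J. card (avoiding_block (a + n - i) i) * card (matching_words N w (a + k) (n - (k + 1 + i))))
      \<le> real (card (matching_words N (l # w) a n))"
    by (rule of_nat_mono)
  then show ?thesis
    by (simp add: card_avoiding_block)
qed

text \<open>Divided by \<open>catalan n\<close>, the lower bound of
  \<open>card_matching_words_Cons\<close> tends to a sum of
  \<open>catalan i / 4 ^ (k + 1 + i)\<close> times the weight of \<open>w\<close>. As the numbers
  \<open>catalan i / (2 * 4 ^ i)\<close> add up to 1, finitely many \<open>i\<close> already recover
  almost all of the factor \<open>1 / (2 * 4 ^ k)\<close>.\<close>

lemma eventually_card_matching_words:
  assumes sums: "(\<lambda>k. catalan k / (2 * 4 ^ k)) sums 1"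
    and "consecutive_words a w" "c < word_prob w"
  shows "eventually (\<lambda>n. c * catalan n \<le> real (card (matching_words N w a n))) sequentially"
  using assms(2,3)
proof (induction w arbitrary: a c)
  case Nil
  then show ?case
    using catalan_pos by (auto simp: matching_words_def card_avoiding_block word_prob_def)
next
  case (Cons l w)
  define k where "k = length l"
  have l: "l \<in> avoiding_block a k" and w: "consecutive_words (a + k) w"
    using Cons.prems by (auto simp: k_def)
  define S where "S = (\<lambda>J. \<Sum>i\<le>J. catalan i / (2 * 4 ^ i))"
  have "S \<longlonglongrightarrow> 1"
    using sums by (simp add: S_def sums_def_le)
  then have "(\<lambda>J. word_prob w / (2 * 4 ^ k) * S J) \<longlonglongrightarrow> word_prob w / (2 * 4 ^ k) * 1"
    by (intro tendsto_intros)
  moreover have "c < word_prob w / (2 * 4 ^ k) * 1"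
    using Cons.prems by (simp add: word_prob_def k_def)
  ultimately have "eventually (\<lambda>J. c < word_prob w / (2 * 4 ^ k) * S J) sequentially"
    by (rule order_tendstoD)
  then obtain J where J: "c < word_prob w / (2 * 4 ^ k) * S J"
    by (auto simp: eventually_sequentially)
  have "0 < S J"
    unfolding S_def by (intro sum_pos) (auto simp: catalan_pos)
  \<comment> \<open>The slack below the target is shared out: truncating at \<open>J\<close> uses
    part of it, and \<open>d\<close> leaves the strict inequality that the induction hypothesis asks
    for.\<close>
  have "c * (2 * 4 ^ k) / S J < word_prob w"
    using J \<open>0 < S J\<close> by (simp add: field_simps)
  then obtain d where "d < word_prob w" "c * (2 * 4 ^ k) / S J < d"
    using dense by blast
  then have d: "d < word_prob w" "c < d / (2 * 4 ^ k) * S J"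
    using \<open>0 < S J\<close> by (auto simp: field_simps)
  have "(\<lambda>n. \<Sum>i\<le>J. catalan i * (d * (catalan (n - (k + 1 + i)) / catalan n)))
      \<longlonglongrightarrow> (\<Sum>i\<le>J. catalan i * (d * (1 / 4 ^ (k + 1 + i))))"
    by (intro tendsto_intros catalan_ratio_shift)
  also have "(\<Sum>i\<le>J. catalan i * (d * (1 / 4 ^ (k + 1 + i)))) = d / (2 * 4 ^ k) * S J"
    unfolding S_def sum_distrib_left by (intro sum.cong) (auto simp: power_add field_simps)
  finally have "eventually
      (\<lambda>n. c < (\<Sum>i\<le>J. catalan i * (d * (catalan (n - (k + 1 + i)) / catalan n)))) sequentially"
    using d by (intro order_tendstoD)
  \<comment> \<open>Only finitely many \<open>i\<close> occur, so the induction hypothesis holds for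
    all of them at once; it is applied at \<open>n - (k + 1 + i)\<close>, which tends to
    infinity.\<close>
  moreover have "eventually (\<lambda>n. \<forall>i\<in>{..J}. d * catalan (n - (k + 1 + i))
      \<le> real (card (matching_words N w (a + k) (n - (k + 1 + i))))) sequentially"
  proof (intro eventually_ball_finite ballI)
    fix i
    show "eventually (\<lambda>n. d * catalan (n - (k + 1 + i))
      \<le> real (card (matching_words N w (a + k) (n - (k + 1 + i))))) sequentially"
      using Cons.IH[OF w d(1)] filterlim_minus_const_nat_at_top[of "k + 1 + i"]
      by (rule eventually_compose_filterlim)
  qed simp
  moreover have "eventually (\<lambda>n. k + 1 + J + N \<le> n) sequentially"
    by (rule eventually_ge_at_top)
  ultimately show ?case
  proof eventually_elim
    case (elim n)
    have "c * catalan n \<le> (\<Sum>i\<le>J. catalan i * (d * (catalan (n - (k + 1 + i)) / catalan n))) * catalan n"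
      using elim(1) by (intro mult_right_mono less_imp_le catalan_pos)
    also have "\<dots> = (\<Sum>i\<le>J. catalan i * (d * catalan (n - (k + 1 + i))))"
      using catalan_pos[of n] by (simp add: sum_distrib_right)
    also have "\<dots> \<le> (\<Sum>i\<le>J. catalan i * real (card (matching_words N w (a + k) (n - (k + 1 + i)))))"
      using elim(2) by (intro sum_mono mult_left_mono) (auto intro: less_imp_le catalan_pos)
    also have "\<dots> \<le> real (card (matching_words N (l # w) a n))"
      by (rule card_matching_words_Cons[OF l elim(3)])
    finally show ?case .
  qed
qed

section \<open>From words to permutations and to cylinders of sequences\<close>

lemma bij_betw_avoiding_perms:
  "bij_betw (\<lambda>p. map p [1..<Suc n]) (avoiding_perms [2,3,1] n) (avoiding_block 0 n)"
proof -
  let ?f = "\<lambda>p::nat \<Rightarrow> nat. map p [1..<Suc n]"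
  let ?P = "{p. p permutes {1..n}}"
  have inj: "inj_on ?f ?P"
  proof (rule inj_onI, rule ext)
    fix p q x assume *: "p \<in> ?P" "q \<in> ?P" "?f p = ?f q"
    show "p x = q x"
    proof (cases "x \<in> {1..n}")
      case True
      then show ?thesis
        using *(3) by (auto simp: map_eq_conv)
    next
      case False
      then show ?thesis
        using * by (auto simp: permutes_def)
    qed
  qed
  have sub: "?f ` ?P \<subseteq> permutations_of_set {1..n}"
  proof safe
    fix p assume p: "p permutes {1..n}"
    have "set (?f p) = p ` {1..n}"
      by (simp only: set_map set_upt) (simp add: atLeastLessThanSuc_atLeastAtMost)
    also have "\<dots> = {1..n}"
      using p by (rule permutes_image)
    finally show "?f p \<in> permutations_of_set {1..n}"
      using permutes_inj_on[OF p] by (auto simp: permutations_of_set_def distinct_map)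
  qed
  \<comment> \<open>Surjectivity onto all listings follows by counting, both sides having
    \<open>n!\<close> elements.\<close>
  have "card (?f ` ?P) = card (permutations_of_set {1..n})"
    using card_image[OF inj] card_permutations[of "{1..n}" n] by simp
  then have eq: "?f ` ?P = permutations_of_set {1..n}"
    using sub by (intro card_subset_eq) auto
  have "?f ` avoiding_perms [2,3,1] n = {xs \<in> ?f ` ?P. avoids [2,3,1] xs}"
    unfolding avoiding_perms_def by blast
  then have "?f ` avoiding_perms [2,3,1] n = avoiding_block 0 n"
    unfolding eq by (simp add: avoiding_block_def avoiding_images_def)
  moreover have "inj_on ?f (avoiding_perms [2,3,1] n)"
    by (rule inj_on_subset[OF inj]) (auto simp: avoiding_perms_def)
  ultimately show ?thesis
    by (simp add: bij_betw_def)
qed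

lemma finite_avoiding_perms: "finite (avoiding_perms [2,3,1] n)"
  using bij_betw_finite[OF bij_betw_avoiding_perms[of n]] by simp

lemma card_avoiding_perms: "real (card (avoiding_perms [2,3,1] n)) = catalan n"
  using bij_betw_same_card[OF bij_betw_avoiding_perms[of n]] by (simp add: card_avoiding_block)

lemma avoiding_perms_nonempty: "avoiding_perms [2,3,1] n \<noteq> {}"
  using card_avoiding_perms[of n] catalan_pos[of n] by auto

lemma perm_to_seq_in_seq_space:
  assumes "p permutes {1..n}"
  shows "perm_to_seq p \<in> seq_space"
proof -
  have "p j \<ge> 1" if "j \<ge> 1" for j
    using permutes_in_image[OF assms, of j] permutes_not_in[OF assms, of j] that
    by (cases "j \<in> {1..n}") auto
  then show ?thesis
    using permutes_inj[OF assms]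
    by (auto simp: seq_space_def perm_to_seq_def Nstar_def one_enat_def inj_on_def)
qed

text \<open>An \<open>\<infinity>\<close> in \<open>W\<close> only demands a value of at least
  \<open>N\<close>, so permutations, which never take the value \<open>\<infinity>\<close>, can lie
  in such a set.\<close>

definition cylinder :: "nat \<Rightarrow> enat list \<Rightarrow> (nat \<Rightarrow> enat) set" where
  "cylinder N W = {\<sigma> \<in> seq_space. list_all2 (approx N) (map \<sigma> [1..<Suc (length W)]) W}"

lemma cylinder_antimono: "m \<le> N \<Longrightarrow> cylinder N W \<subseteq> cylinder m W"
  unfolding cylinder_def approx_def
  by (auto elim!: list_all2_mono split: if_splits intro: order_trans[of "enat m" "enat N"] simp del: upt_Suc)

text \<open>When \<open>N\<close> exceeds all entries, turning every value of at least
  \<open>N\<close> into \<open>\<infinity>\<close>, as \<open>t\<close> does, recovers the code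
  exactly from the sequence. Both codes are then prefixes of one sequence, and prefix-freeness makes
  them equal.\<close>

lemma cylinder_with_infinities_disjoint:
  assumes "length w = length w'" "\<sigma> \<in> cylinder N (with_infinities w)" "\<sigma> \<in> cylinder N (with_infinities w')"
    and "\<forall>l\<in>set w \<union> set w'. \<forall>x\<in>set l. x < N"
  shows "w = w'"
proof -
  define t where "t = (\<lambda>x. if enat N \<le> x then \<infinity> else x)"
  have *: "map (t \<circ> \<sigma>) [1..<Suc (length (with_infinities w))] = with_infinities w"
    if "\<sigma> \<in> cylinder N (with_infinities w)" "\<forall>l\<in>set w. \<forall>x\<in>set l. x < N" for w
  proof -
    have "\<forall>x\<in>set (with_infinities w). x = \<infinity> \<or> x < enat N"
      using that(2) by (induction w) auto
    moreover have "map t xs = W" if "list_all2 (approx N) xs W" "\<forall>x\<in>set W. x = \<infinity> \<or> x < enat N" for xs W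
      using that by (induction rule: list_all2_induct) (auto simp: t_def approx_def split: if_splits)
    ultimately have "map t (map \<sigma> [1..<Suc (length (with_infinities w))]) = with_infinities w"
      using that(1) unfolding cylinder_def by blast
    then show ?thesis
      by (simp only: map_map)
  qed
  \<comment> \<open>Both codes are extended to a common length, so that they appear as prefixes of
    the same list.\<close>
  define L where "L = length (with_infinities w) + length (with_infinities w')"
  have **: "map (t \<circ> \<sigma>) [1..<Suc L]
      = with_infinities w @ map (t \<circ> \<sigma>) [Suc (length (with_infinities w))..<Suc L]"
    if "map (t \<circ> \<sigma>) [1..<Suc (length (with_infinities w))] = with_infinities w"
      "length (with_infinities w) \<le> L" for w
  proof -
    have "[1..<Suc L] = [1..<Suc (length (with_infinities w))] @ [Suc (length (with_infinities w))..<Suc L]"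
      using that(2) upt_add_eq_append[of 1 "Suc (length (with_infinities w))" "L - length (with_infinities w)"]
      by simp
    then show ?thesis
      using that(1) by (metis map_append)
  qed
  show ?thesis
  proof (rule with_infinities_eqD[OF assms(1)])
    have "map (t \<circ> \<sigma>) [1..<Suc (length (with_infinities v))] = with_infinities v"
      "length (with_infinities v) \<le> L" if "v \<in> {w, w'}" for v
      using that assms *[of v] by (auto simp: L_def simp del: upt_Suc)
    then show "with_infinities w @ map (t \<circ> \<sigma>) [Suc (length (with_infinities w))..<Suc L]
      = with_infinities w' @ map (t \<circ> \<sigma>) [Suc (length (with_infinities w'))..<Suc L]"
      using **[of w] **[of w'] by simp
  qed
qed

lemma perm_to_seq_in_cylinder:
  assumes "p permutes {1..n}" "starts_like N W (map p [1..<Suc n])"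
  shows "perm_to_seq p \<in> cylinder N W"
proof -
  obtain ys zs where *: "map enat (map p [1..<Suc n]) = ys @ zs" "list_all2 (approx N) ys W"
    using assms by (auto simp: starts_like_def)
  have len: "length W = length ys"
    using * by (simp add: list_all2_lengthD)
  moreover have "length ys \<le> n"
    using arg_cong[OF *(1), of length] by (simp del: upt_Suc)
  ultimately have "ys = take (length W) (map (\<lambda>j. enat (p j)) [1..<Suc n])"
    using *(1) by (simp add: comp_def)
  also have "\<dots> = map (\<lambda>j. enat (p j)) (take (length W) [1..<Suc n])"
    by (simp add: take_map)
  also have "take (length W) [1..<Suc n] = [1..<Suc (length W)]"
    using len \<open>length ys \<le> n\<close> by (subst take_upt) auto
  also have "map (\<lambda>j. enat (p j)) [1..<Suc (length W)] = map (perm_to_seq p) [1..<Suc (length W)]"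
    by (auto simp: perm_to_seq_def)
  finally show ?thesis
    using * perm_to_seq_in_seq_space[OF assms(1)] by (simp add: cylinder_def)
qed

lemma card_matching_words_le:
  "card (matching_words N w 0 n)
    \<le> card {p \<in> avoiding_perms [2,3,1] n. perm_to_seq p \<in> cylinder N (with_infinities w)}"
proof -
  let ?f = "\<lambda>p::nat \<Rightarrow> nat. map p [1..<Suc n]"
  let ?C = "{p \<in> avoiding_perms [2,3,1] n. perm_to_seq p \<in> cylinder N (with_infinities w)}"
  have "matching_words N w 0 n \<subseteq> ?f ` ?C"
  proof
    fix xs assume xs: "xs \<in> matching_words N w 0 n"
    then have "xs \<in> ?f ` avoiding_perms [2,3,1] n"
      using bij_betw_imp_surj_on[OF bij_betw_avoiding_perms[of n]]
      unfolding matching_words_def by blast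
    then obtain p where p: "p \<in> avoiding_perms [2,3,1] n" "xs = ?f p"
      by blast
    moreover have "perm_to_seq p \<in> cylinder N (with_infinities w)"
      using p xs by (intro perm_to_seq_in_cylinder[of _ n]) (auto simp: avoiding_perms_def matching_words_def)
    ultimately show "xs \<in> ?f ` ?C"
      by blast
  qed
  moreover have fin: "finite ?C"
    by (rule finite_subset[OF _ finite_avoiding_perms[of n]]) blast
  ultimately have "card (matching_words N w 0 n) \<le> card (?f ` ?C)"
    by (intro card_mono finite_imageI fin)
  also have "\<dots> \<le> card ?C"
    by (intro card_image_le fin)
  finally show ?thesis .
qed


section \<open>Cylinders and open sets\<close>

lemma tail_weight_nonneg: "0 \<le> tail_weight i"
  by (simp add: tail_weight_def infsum_nonneg)

lemma tail_weight_infinity [simp]: "tail_weight \<infinity> = 0"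
  by (simp add: tail_weight_def)

lemma tail_weight_antimono: "i \<le> j \<Longrightarrow> tail_weight j \<le> tail_weight i"
  using tail_weight_less[of i j] by (cases "i = j") (auto simp: order.strict_iff_order)

lemma tail_weight_enat: "tail_weight (enat m) = (1/2) ^ m * tail_weight 0"
proof -
  have "{k. enat m \<le> enat k} = (\<lambda>j. m + j) ` UNIV"
    by (auto simp: image_iff nat_le_iff_add)
  then have "tail_weight (enat m) = (\<Sum>\<^sub>\<infinity>j. (1/2) ^ (m + j))"
    unfolding tail_weight_def by (simp add: infsum_reindex inj_def comp_def)
  also have "\<dots> = (1/2) ^ m * (\<Sum>\<^sub>\<infinity>j. (1/2) ^ j)"
    by (simp only: power_add infsum_cmult_right')
  finally show ?thesis
    by (simp add: tail_weight_def)
qed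

lemma tail_weight_tendsto_0: "(\<lambda>m. tail_weight (enat m)) \<longlonglongrightarrow> 0"
proof -
  have "(\<lambda>m. (1/2) ^ m * tail_weight 0) \<longlonglongrightarrow> 0 * tail_weight 0"
    by (intro tendsto_intros) auto
  then show ?thesis
    by (simp add: tail_weight_enat)
qed

lemma dist_Nstar_approx:
  assumes "approx N x y"
  shows "dist_Nstar x y \<le> tail_weight (enat N)"
proof (cases "y = \<infinity>")
  case True
  then show ?thesis
    using assms tail_weight_antimono[of "enat N" x] tail_weight_nonneg[of x]
    by (simp add: dist_Nstar_eq approx_def)
next
  case False
  then show ?thesis
    using assms tail_weight_nonneg by (simp add: dist_Nstar_eq approx_def)
qed

text \<open>The first \<open>m\<close> coordinates are close by assumption and enter with geometric
  weights. The others are only bounded, but their total weight is a geometric tail. Each part is at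
  most \<open>tail_weight 0 * tail_weight (enat m)\<close>.\<close>

lemma dist_seq_le:
  assumes "\<And>i. 1 \<le> i \<Longrightarrow> i \<le> m \<Longrightarrow> approx m (\<sigma> i) (\<rho> i)"
  shows "dist_seq \<sigma> \<rho> \<le> 2 * (tail_weight 0 * tail_weight (enat m))"
proof -
  let ?t = "\<lambda>i. (1/2) ^ i * dist_Nstar (\<sigma> i) (\<rho> i)"
  have "{1..} = {1..m} \<union> {Suc m..}"
    by auto
  then have "dist_seq \<sigma> \<rho> = (\<Sum>\<^sub>\<infinity>i\<in>{1..m} \<union> {Suc m..}. ?t i)"
    unfolding dist_seq_def by simp
  also have "\<dots> = (\<Sum>\<^sub>\<infinity>i\<in>{1..m}. ?t i) + (\<Sum>\<^sub>\<infinity>i\<in>{Suc m..}. ?t i)"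
    by (intro infsum_Un_disjoint summable_on_subset_banach[OF summable_dist_seq]) auto
  also have "(\<Sum>\<^sub>\<infinity>i\<in>{1..m}. ?t i) \<le> (\<Sum>\<^sub>\<infinity>i\<in>{1..m}. (1/2) ^ i * tail_weight (enat m))"
    using assms by (intro infsum_mono summable_on_finite mult_left_mono dist_Nstar_approx) auto
  also have "\<dots> \<le> (\<Sum>\<^sub>\<infinity>i\<in>{k. 0 \<le> enat k}. (1/2) ^ i * tail_weight (enat m))"
    by (intro infsum_mono2 summable_on_finite summable_on_cmult_left summable_half)
      (auto simp: tail_weight_nonneg)
  also have "\<dots> = tail_weight 0 * tail_weight (enat m)"
    by (simp only: infsum_cmult_left' tail_weight_def)
  also have "(\<Sum>\<^sub>\<infinity>i\<in>{Suc m..}. ?t i) \<le> (\<Sum>\<^sub>\<infinity>i\<in>{Suc m..}. (1/2) ^ i * tail_weight 0)"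
    by (intro infsum_mono summable_on_subset_banach[OF summable_dist_seq]
        summable_on_cmult_left summable_half mult_left_mono dist_Nstar_bound) auto
  also have "\<dots> \<le> (\<Sum>\<^sub>\<infinity>i\<in>{k. enat m \<le> enat k}. (1/2) ^ i * tail_weight 0)"
    by (intro infsum_mono2 summable_on_cmult_left summable_half) (auto simp: tail_weight_nonneg)
  also have "\<dots> = tail_weight 0 * tail_weight (enat m)"
    by (simp only: infsum_cmult_left' tail_weight_def mult.commute)
  finally show ?thesis
    by simp
qed

lemma self_in_cylinder:
  assumes "\<rho> \<in> seq_space" "map \<rho> [1..<Suc (length W)] = W"
  shows "\<rho> \<in> cylinder N W"
  unfolding cylinder_def
  using assms by (auto simp: list_all2_same approx_def simp del: upt_Suc)

text \<open>The one parameter \<open>m\<close> controls both the number of prescribed coordinates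
  and the threshold standing for \<open>\<infinity>\<close>; the diameter bound of
  \<open>dist_seq_le\<close> therefore tends to 0.\<close>

lemma cylinder_subset_open:
  assumes U: "openin seq_topology U" "\<rho> \<in> U"
  shows "eventually (\<lambda>m. \<forall>W. m \<le> length W \<longrightarrow> map \<rho> [1..<Suc (length W)] = W \<longrightarrow> cylinder m W \<subseteq> U)
           sequentially"
proof -
  interpret Metric_space seq_space dist_seq
    by (rule Metric_space_seq_space)
  have "U \<subseteq> seq_space" "\<exists>r>0. mball \<rho> r \<subseteq> U"
    using U by (auto simp: seq_topology_def openin_mtopology)
  then obtain r where r: "0 < r" "mball \<rho> r \<subseteq> U" and "\<rho> \<in> seq_space"
    using U by blast
  have "(\<lambda>m. 2 * (tail_weight 0 * tail_weight (enat m))) \<longlonglongrightarrow> 2 * (tail_weight 0 * 0)"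
    by (intro tendsto_intros tail_weight_tendsto_0)
  then have "eventually (\<lambda>m. 2 * (tail_weight 0 * tail_weight (enat m)) < r) sequentially"
    using r by (intro order_tendstoD) auto
  then show ?thesis
  proof eventually_elim
    case (elim m)
    have "\<sigma> \<in> U" if W: "m \<le> length W" "map \<rho> [1..<Suc (length W)] = W" and \<sigma>: "\<sigma> \<in> cylinder m W" for W \<sigma>
    proof -
      have *: "list_all2 (approx m) (map \<sigma> [1..<Suc (length W)]) (map \<rho> [1..<Suc (length W)])"
        using \<sigma> W(2) unfolding cylinder_def by (simp del: upt_Suc)
      have "approx m (\<sigma> i) (\<rho> i)" if "1 \<le> i" "i \<le> m" for i
        using list_all2_nthD2[OF *, of "i - 1"] that W(1) by (simp del: upt_Suc)
      then have "dist_seq \<sigma> \<rho> < r"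
        using dist_seq_le[of m \<sigma> \<rho>] elim by force
      then show ?thesis
        using r \<sigma> \<open>\<rho> \<in> seq_space\<close> by (auto simp: cylinder_def commute)
    qed
    then show ?case
      by blast
  qed
qed

section \<open>Borel sets of the sequence space and integrals over the uniform measures\<close>

lemma space_borel_sigma [simp]: "space (borel_sigma seq_topology) = seq_space"
  unfolding borel_sigma_def topspace_seq_topology[symmetric]
  by (rule space_measure_of) (auto dest: openin_subset)

lemma measurable_borel_sigmaI:
  assumes "f \<in> space M \<rightarrow> seq_space"
    and "\<And>U. openin seq_topology U \<Longrightarrow> f -` U \<inter> space M \<in> sets M"
  shows "f \<in> measurable M (borel_sigma seq_topology)"
  unfolding borel_sigma_def
  by (rule measurable_measure_of) (use assms openin_subset[of seq_topology] in \<open>auto simp: topspace_seq_topology\<close>)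

lemma open_in_borel_sigma: "openin seq_topology U \<Longrightarrow> U \<in> sets (borel_sigma seq_topology)"
  unfolding borel_sigma_def by (subst sets_measure_of) (auto dest: openin_subset)

lemma continuous_map_borel_measurable:
  fixes f :: "(nat \<Rightarrow> enat) \<Rightarrow> real"
  assumes "continuous_map seq_topology euclideanreal f"
  shows "f \<in> borel_measurable (borel_sigma seq_topology)"
proof (rule borel_measurableI)
  fix S :: "real set" assume "open S"
  then have "openin seq_topology {x \<in> topspace seq_topology. f x \<in> S}"
    using assms by (intro openin_continuous_map_preimage) auto
  moreover have "{x \<in> topspace seq_topology. f x \<in> S} = f -` S \<inter> space (borel_sigma seq_topology)"
    by (auto simp: topspace_seq_topology)
  ultimately show "f -` S \<inter> space (borel_sigma seq_topology) \<in> sets (borel_sigma seq_topology)"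
    by (metis open_in_borel_sigma)
qed

lemma perm_to_seq_measurable:
  "perm_to_seq \<in> measurable (uniform_count_measure (avoiding_perms [2,3,1] n)) (borel_sigma seq_topology)"
  by (intro measurable_borel_sigmaI)
    (auto simp: space_uniform_count_measure sets_uniform_count_measure avoiding_perms_def
      perm_to_seq_in_seq_space)

lemma uniform_avoiding_in_prob_measures_on:
  "uniform_avoiding [2,3,1] n \<in> prob_measures_on seq_topology"
  unfolding prob_measures_on_def uniform_avoiding_def
  by (auto intro!: prob_space.prob_space_distr prob_space_uniform_count_measure perm_to_seq_measurable
      simp: finite_avoiding_perms avoiding_perms_nonempty simp del: One_nat_def)

lemma integral_uniform_avoiding:
  fixes f :: "(nat \<Rightarrow> enat) \<Rightarrow> real"
  assumes "f \<in> borel_measurable (borel_sigma seq_topology)"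
  shows "(\<integral>\<sigma>. f \<sigma> \<partial>uniform_avoiding [2,3,1] n)
    = (\<Sum>p\<in>avoiding_perms [2,3,1] n. f (perm_to_seq p)) / catalan n"
proof -
  have "(\<integral>\<sigma>. f \<sigma> \<partial>uniform_avoiding [2,3,1] n)
      = (\<integral>p. f (perm_to_seq p) \<partial>uniform_count_measure (avoiding_perms [2,3,1] n))"
    unfolding uniform_avoiding_def by (intro integral_distr perm_to_seq_measurable assms)
  also have "\<dots> = (\<Sum>p\<in>avoiding_perms [2,3,1] n. f (perm_to_seq p)) / card (avoiding_perms [2,3,1] n)"
    by (simp add: uniform_count_measure_def lebesgue_integral_point_measure_finite finite_avoiding_perms sum_divide_distrib
        del: One_nat_def)
  finally show ?thesis
    by (simp only: card_avoiding_perms)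
qed


section \<open>The limiting random sequence\<close>

lemma with_infinities_snoc: "with_infinities (w @ [l]) = with_infinities w @ map enat l @ [\<infinity>]"
  by (induction w) auto

lemma set_with_infinities: "set (with_infinities w) = enat ` set (concat w) \<union> (if w = [] then {} else {\<infinity>})"
  by (induction w) auto

lemma filter_with_infinities: "filter (\<lambda>x. x \<noteq> \<infinity>) (with_infinities w) = map enat (concat w)"
proof -
  have *: "filter (\<lambda>x. x \<noteq> \<infinity>) (map enat l) = map enat l" for l
    by (simp add: filter_id_conv)
  show ?thesis
    by (induction w) (simp_all add: *)
qed

lemma concat_consecutive_words:
  "consecutive_words a w \<Longrightarrow> concat w \<in> avoiding_block a (sum_list (map length w))"
  by (induction w arbitrary: a) (auto intro: append_avoiding_block)

text \<open>With \<open>P\<close> selecting the finite entries, this gives injectivity away from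
  \<open>\<infinity>\<close>: filtering discards the repeated \<open>\<infinity>\<close> and leaves
  a list without repetitions.\<close>

lemma distinct_filter_nth_eq:
  assumes "distinct (filter P xs)" "i < j" "j < length xs" "P (xs ! i)"
  shows "xs ! i \<noteq> xs ! j"
proof
  assume eq: "xs ! i = xs ! j"
  have "xs = take j xs @ xs ! j # drop (Suc j) xs"
    using assms by (intro id_take_nth_drop)
  then have "distinct (filter P (take j xs) @ xs ! i # filter P (drop (Suc j) xs))"
    using assms(1,4) eq by (metis filter.simps(2) filter_append)
  moreover have "xs ! i \<in> set (take j xs)"
    using assms by (auto simp: in_set_conv_nth intro!: exI[of _ i])
  ultimately show False
    using assms(4) by auto
qed

text \<open>Each entry is read off from the shortest sufficient concatenation, and this is a prefix
  of every longer one, in particular of \<open>W\<close>.\<close>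

lemma inf_concat_prefix:
  assumes W: "W = concat (map L [1..<Suc m])"
  shows "map (inf_concat L) [1..<Suc (length W)] = W"
proof (rule nth_equalityI)
  fix i assume "i < length (map (inf_concat L) [1..<Suc (length W)])"
  then have i: "i < length W"
    by (simp del: upt_Suc)
  define N where "N = (LEAST N. Suc i \<le> length (concat (map L [1..<Suc N])))"
  have m: "Suc i \<le> length (concat (map L [1..<Suc m]))"
    using i W by simp
  have N: "Suc i \<le> length (concat (map L [1..<Suc N]))"
    unfolding N_def by (rule LeastI[of _ m]) (rule m)
  have "N \<le> m"
    unfolding N_def by (rule Least_le) (rule m)
  then have "[1..<Suc m] = [1..<Suc N] @ [Suc N..<Suc m]"
    using upt_add_eq_append[of 1 "Suc N" "m - N"] by simp
  then have "W = concat (map L [1..<Suc N]) @ concat (map L [Suc N..<Suc m])"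
    unfolding W by (metis concat_append map_append)
  then have "W ! i = concat (map L [1..<Suc N]) ! i"
    using N by (simp add: nth_append del: upt_Suc)
  also have "\<dots> = inf_concat L (Suc i)"
    by (simp add: inf_concat_def Let_def N_def del: upt_Suc)
  finally show "map (inf_concat L) [1..<Suc (length W)] ! i = W ! i"
    using i by (simp del: upt_Suc)
qed (simp del: upt_Suc)

section \<open>The random blocks and the law of the first \<open>m\<close> of them\<close>

locale random_words = prob_space M for M :: "'w measure" +
  fixes X :: "nat \<Rightarrow> 'w \<Rightarrow> nat"
    and R :: "nat set \<Rightarrow> 'w \<Rightarrow> nat list"
  assumes X_measurable: "\<And>n. n \<ge> 1 \<Longrightarrow> X n \<in> measurable M (count_space UNIV)"
    and X_distribution: "\<And>n k. n \<ge> 1 \<Longrightarrow> prob {\<omega> \<in> space M. X n \<omega> = k} = catalan k / (2 * 4 ^ k)"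
    and R_measurable:
      "\<And>I. I \<in> blocks \<Longrightarrow> R I \<in> measurable M (count_space (avoiding_images [2,3,1] I))"
    and R_uniform:
      "\<And>I. I \<in> blocks \<Longrightarrow> distr M (count_space (avoiding_images [2,3,1] I)) (R I)
                            = uniform_count_measure (avoiding_images [2,3,1] I)"
    and independent:
      "indep_vars (\<lambda>_. count_space UNIV) (joint_family X R) (Inl ` {1..} \<union> Inr ` blocks)"
begin

text \<open>List position \<open>i\<close> holds the block with number \<open>i + 1\<close>, since
  the random blocks are counted from 1.\<close>

definition words :: "nat \<Rightarrow> 'w \<Rightarrow> nat list list" where
  "words m \<omega> = map (\<lambda>i. R {partial_sum X i \<omega> + 1..partial_sum X (Suc i) \<omega>} \<omega>) [0..<m]"

lemma length_words [simp]: "length (words m \<omega>) = m"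
  by (simp add: words_def)

lemma partial_sum_Suc [simp]: "partial_sum X (Suc i) \<omega> = partial_sum X i \<omega> + X (Suc i) \<omega>"
  by (simp add: partial_sum_def)

lemma partial_sum_0 [simp]: "partial_sum X 0 \<omega> = 0"
  by (simp add: partial_sum_def)

lemma block_in_blocks: "{a + 1..a + k} \<in> blocks"
  unfolding blocks_def by (intro CollectI exI[of _ "a + 1"] exI[of _ "a + k"]) auto

lemma R_block: "\<omega> \<in> space M \<Longrightarrow> R {a + 1..a + k} \<omega> \<in> avoiding_block a k"
  using measurable_space[OF R_measurable[OF block_in_blocks[of a k]]]
  by (simp add: avoiding_block_def)

lemma words_nth:
  assumes "\<omega> \<in> space M" "i < m"
  shows "words m \<omega> ! i \<in> avoiding_block (partial_sum X i \<omega>) (X (Suc i) \<omega>)"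
  using R_block[OF assms(1), of "partial_sum X i \<omega>" "X (Suc i) \<omega>"] assms(2)
  by (simp add: words_def)

lemma sum_lengths_words:
  assumes "\<omega> \<in> space M"
  shows "i \<le> m \<Longrightarrow> sum_list (map length (take i (words m \<omega>))) = partial_sum X i \<omega>"
proof (induction i)
  case (Suc i)
  then show ?case
    using length_avoiding_block[OF words_nth[OF assms, of i m]] by (simp add: take_Suc_conv_app_nth)
qed simp

lemma consecutive_words_words:
  assumes "\<omega> \<in> space M"
  shows "consecutive_words 0 (words m \<omega>)"
  unfolding consecutive_words_iff_nth
  using words_nth[OF assms, of _ m] length_avoiding_block[OF words_nth[OF assms, of _ m]]
  by (auto simp: sum_lengths_words[OF assms])

lemma concat_words:
  assumes "\<omega> \<in> space M"
  shows "concat (words m \<omega>) \<in> avoiding_block 0 (partial_sum X m \<omega>)"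
  using concat_consecutive_words[OF consecutive_words_words[OF assms, of m]]
    sum_lengths_words[OF assms, of m m] by simp

lemma random_concat_prefix:
  "map (random_concat X R \<omega>) [1..<Suc (length (with_infinities (words m \<omega>)))] = with_infinities (words m \<omega>)"
  unfolding random_concat_def
proof (rule inf_concat_prefix)
  show "with_infinities (words m \<omega>) = concat (map (\<lambda>n. map enat
      (R {partial_sum X (n - 1) \<omega> + 1..partial_sum X n \<omega>} \<omega>) @ [\<infinity>]) [1..<Suc m])"
    by (induction m) (auto simp: words_def with_infinities_snoc)
qed

text \<open>Every word, even an empty one, brings its own \<open>\<infinity>\<close>, so
  \<open>m\<close> words always cover the first \<open>m\<close> positions.\<close>

lemma random_concat_eq:
  assumes "1 \<le> j" "j \<le> m"
  shows "j - 1 < length (with_infinities (words m \<omega>))"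
    and "random_concat X R \<omega> j = with_infinities (words m \<omega>) ! (j - 1)"
proof -
  show *: "j - 1 < length (with_infinities (words m \<omega>))"
    using length_le_with_infinities[of "words m \<omega>"] assms by simp
  have "with_infinities (words m \<omega>) ! (j - 1)
      = map (random_concat X R \<omega>) [1..<Suc (length (with_infinities (words m \<omega>)))] ! (j - 1)"
    by (simp only: random_concat_prefix)
  also have "\<dots> = random_concat X R \<omega> j"
    using * assms by (simp del: upt_Suc)
  finally show "random_concat X R \<omega> j = with_infinities (words m \<omega>) ! (j - 1)"
    by simp
qed

text \<open>For every outcome, the first \<open>j\<close> positions are covered by the first
  \<open>j\<close> words, whose concatenation lists an initial segment of the positive integers
  without repetition; everything else is \<open>\<infinity>\<close>.\<close>

lemma random_concat_in_seq_space:
  assumes \<omega>: "\<omega> \<in> space M"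
  shows "random_concat X R \<omega> \<in> seq_space"
proof -
  let ?\<sigma> = "random_concat X R \<omega>"
  have "?\<sigma> j \<in> Nstar" if "1 \<le> j" for j
  proof -
    have "?\<sigma> j \<in> set (with_infinities (words j \<omega>))"
      using random_concat_eq[OF that order_refl, of \<omega>] by simp
    moreover have "set (concat (words j \<omega>)) \<subseteq> {1..}"
      using concat_words[OF \<omega>, of j] by (auto simp: mem_avoiding_block)
    ultimately show ?thesis
      by (auto simp: set_with_infinities Nstar_def one_enat_def split: if_splits)
  qed
  moreover have "?\<sigma> i \<noteq> ?\<sigma> j" if "1 \<le> i" "i < j" "?\<sigma> i \<noteq> \<infinity>" for i j
  proof -
    have "distinct (concat (words j \<omega>))"
      using concat_words[OF \<omega>, of j] by (simp add: mem_avoiding_block)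
    then have "distinct (filter (\<lambda>x. x \<noteq> \<infinity>) (with_infinities (words j \<omega>)))"
      unfolding filter_with_infinities by (simp add: distinct_map inj_on_def del: distinct_concat_iff)
    from distinct_filter_nth_eq[OF this, of "i - 1" "j - 1"] show ?thesis
      using that random_concat_eq[of i j \<omega>] random_concat_eq[of j j \<omega>] by auto
  qed
  then have "inj_on ?\<sigma> {i \<in> {1..}. ?\<sigma> i \<noteq> \<infinity>}"
    by (intro linorder_inj_onI') auto
  moreover have "?\<sigma> \<in> extensional {1..}"
    by (simp add: random_concat_def inf_concat_def)
  ultimately show ?thesis
    by (auto simp: seq_space_def PiE_def)
qed

lemma random_concat_in_cylinder:
  "\<omega> \<in> space M \<Longrightarrow> random_concat X R \<omega> \<in> cylinder N (with_infinities (words m \<omega>))"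
  by (intro self_in_cylinder random_concat_in_seq_space random_concat_prefix)

lemma eventually_cylinder_words_subset:
  assumes "openin seq_topology U" "random_concat X R \<omega> \<in> U"
  shows "eventually (\<lambda>m. cylinder m (with_infinities (words m \<omega>)) \<subseteq> U) sequentially"
  using cylinder_subset_open[OF assms]
proof eventually_elim
  case (elim m)
  then show ?case
    using length_le_with_infinities[of "words m \<omega>"] random_concat_prefix[of \<omega> m] by simp
qed

text \<open>The blocks indexing \<open>R\<close> in \<open>words\<close> are random. On this event
  they are forced to be the fixed blocks given by the lengths in \<open>w\<close>, which makes
  independence applicable.\<close>

lemma words_eq_iff:
  assumes \<omega>: "\<omega> \<in> space M"
  shows "words (length w) \<omega> = w \<longleftrightarrow>
    (\<forall>i<length w. X (Suc i) \<omega> = length (w ! i) \<and>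
       R {sum_list (map length (take i w)) + 1..sum_list (map length (take i w)) + length (w ! i)} \<omega> = w ! i)"
    (is "?L \<longleftrightarrow> ?R")
proof
  assume ?L
  then have eq: "words (length w) \<omega> = w" .
  show ?R
  proof (intro allI impI)
    fix i assume i: "i < length w"
    have "length (w ! i) = X (Suc i) \<omega>"
      using length_avoiding_block[OF words_nth[OF \<omega> i]] eq by simp
    moreover have "sum_list (map length (take i w)) = partial_sum X i \<omega>"
      using sum_lengths_words[OF \<omega>, of i "length w"] eq i by simp
    moreover have "words (length w) \<omega> ! i = w ! i"
      using eq by simp
    then have "R {partial_sum X i \<omega> + 1..partial_sum X (Suc i) \<omega>} \<omega> = w ! i"
      using i by (simp add: words_def)
    ultimately show "X (Suc i) \<omega> = length (w ! i) \<and>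
       R {sum_list (map length (take i w)) + 1..sum_list (map length (take i w)) + length (w ! i)} \<omega> = w ! i"
      by simp
  qed
next
  assume r: ?R
  have *: "sum_list (map length (take i w)) = partial_sum X i \<omega>" if "i \<le> length w" for i
    using that by (induction i) (use r in \<open>auto simp: take_Suc_conv_app_nth\<close>)
  show ?L
    by (rule nth_equalityI) (use r * in \<open>auto simp: words_def\<close>)
qed

lemma X_event: "1 \<le> n \<Longrightarrow> {\<omega> \<in> space M. X n \<omega> = k} \<in> events"
  using measurable_sets[OF X_measurable, of n "{k}"] by (simp add: vimage_def Int_def conj_commute)

lemma R_event:
  assumes "l \<in> avoiding_block a k"
  shows "{\<omega> \<in> space M. R {a + 1..a + k} \<omega> = l} \<in> events"
    and "prob {\<omega> \<in> space M. R {a + 1..a + k} \<omega> = l} = 1 / catalan k"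
proof -
  note meas = R_measurable[OF block_in_blocks, of a k, folded avoiding_block_def]
  have eq: "{\<omega> \<in> space M. R {a + 1..a + k} \<omega> = l} = R {a + 1..a + k} -` {l} \<inter> space M"
    by auto
  show "{\<omega> \<in> space M. R {a + 1..a + k} \<omega> = l} \<in> events"
    unfolding eq using assms by (intro measurable_sets[OF meas]) simp
  have "prob (R {a + 1..a + k} -` {l} \<inter> space M)
      = measure (distr M (count_space (avoiding_block a k)) (R {a + 1..a + k})) {l}"
    using assms by (subst measure_distr[OF meas]) auto
  also have "\<dots> = measure (uniform_count_measure (avoiding_block a k)) {l}"
    using R_uniform[OF block_in_blocks, of a k, folded avoiding_block_def] by simp
  also have "\<dots> = 1 / catalan k"
    using assms by (simp add: measure_uniform_count_measure card_avoiding_block)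
  finally show "prob {\<omega> \<in> space M. R {a + 1..a + k} \<omega> = l} = 1 / catalan k"
    unfolding eq .
qed

lemma words_event: "{\<omega> \<in> space M. words m \<omega> = w} \<in> events"
proof (cases "length w = m \<and> consecutive_words 0 w")
  case True
  let ?P = "\<lambda>i \<omega>. X (Suc i) \<omega> = length (w ! i) \<and>
    R {sum_list (map length (take i w)) + 1..sum_list (map length (take i w)) + length (w ! i)} \<omega> = w ! i"
  have "{\<omega> \<in> space M. ?P i \<omega>} \<in> events" if "i < m" for i
    using True that unfolding consecutive_words_iff_nth
    by (intro sets.sets_Collect_conj X_event R_event(1)) auto
  then have "{\<omega> \<in> space M. \<forall>i\<in>{..<m}. ?P i \<omega>} \<in> events"
    by (intro sets.sets_Collect_finite_All) auto
  moreover have "{\<omega> \<in> space M. words m \<omega> = w} = {\<omega> \<in> space M. \<forall>i\<in>{..<m}. ?P i \<omega>}"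
    using words_eq_iff[of _ w] True by auto
  ultimately show ?thesis
    by (simp only:)
next
  case False
  then have "{\<omega> \<in> space M. words m \<omega> = w} = {}"
    using consecutive_words_words by auto
  then show ?thesis
    by (simp only: sets.empty_sets)
qed

lemma words_measurable: "words m \<in> measurable M (count_space UNIV)"
proof -
  have "words m -` {w} \<inter> space M = {\<omega> \<in> space M. words m \<omega> = w}" for w
    by auto
  then show ?thesis
    using words_event by (auto simp: measurable_count_space_eq2_countable)
qed

text \<open>The sequence lies in an open set exactly if, for some \<open>m\<close>, the whole
  cylinder of its first \<open>m\<close> words does. Since there are only countably many lists of
  words, the preimage is a countable union of events.\<close>

lemma random_concat_measurable: "random_concat X R \<in> measurable M (borel_sigma seq_topology)"
proof (rule measurable_borel_sigmaI)
  show "random_concat X R \<in> space M \<rightarrow> seq_space"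
    using random_concat_in_seq_space by blast
  fix U assume U: "openin seq_topology U"
  have "random_concat X R -` U \<inter> space M
      = (\<Union>m. \<Union>w\<in>{w. cylinder m (with_infinities w) \<subseteq> U}. {\<omega> \<in> space M. words m \<omega> = w})"
    (is "?L = ?R")
  proof (intro subset_antisym subsetI)
    fix \<omega> assume "\<omega> \<in> ?L"
    then have "eventually (\<lambda>m. cylinder m (with_infinities (words m \<omega>)) \<subseteq> U) sequentially" "\<omega> \<in> space M"
      using eventually_cylinder_words_subset[OF U] by auto
    then show "\<omega> \<in> ?R"
      by (auto simp: eventually_sequentially)
  next
    fix \<omega> assume "\<omega> \<in> ?R"
    then obtain m where "\<omega> \<in> space M" "cylinder m (with_infinities (words m \<omega>)) \<subseteq> U"
      by auto
    then show "\<omega> \<in> ?L"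
      using random_concat_in_cylinder[of \<omega> m m] by auto
  qed
  also have "\<dots> \<in> events"
    by (intro sets.countable_UN'' sets.countable_UN' words_event) auto
  finally show "random_concat X R -` U \<inter> space M \<in> events" .
qed

text \<open>The value of the series is read off from the total mass of \<open>X 1\<close>, whose law
  is given.\<close>

lemma catalan_sums: "(\<lambda>k. catalan k / (2 * 4 ^ k)) sums 1"
proof -
  have "(\<lambda>k. prob {\<omega> \<in> space M. X 1 \<omega> = k}) sums prob (\<Union>k. {\<omega> \<in> space M. X 1 \<omega> = k})"
    by (rule finite_measure_UNION) (auto intro: X_event simp: disjoint_family_on_def)
  moreover have "(\<Union>k. {\<omega> \<in> space M. X 1 \<omega> = k}) = space M"
    by auto
  ultimately show ?thesis
    using X_distribution[of 1] by (simp add: prob_space)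
qed

text \<open>Only the nonempty blocks are pairwise distinct; the variable of the empty block is
  constant and contributes the factor 1.\<close>

lemma prob_words:
  assumes w: "consecutive_words 0 w"
  shows "prob {\<omega> \<in> space M. words (length w) \<omega> = w} = word_prob w"
\<comment> \<open>For the empty list the index set \<open>J\<close> below would be empty, while the
  product rule for independent variables asks for a nonempty one.\<close>
proof (cases "w = []")
  case True
  then show ?thesis
    by (simp add: words_def word_prob_def prob_space)
next
  case False
  define k where "k = (\<lambda>i. length (w ! i))"
  define S where "S = (\<lambda>i. sum_list (map length (take i w)))"
  define B where "B = (\<lambda>i. {S i + 1..S i + k i})"
  define K where "K = {i. i < length w \<and> 0 < k i}"
  have [simp]: "finite K"
    by (simp add: K_def)
  have w': "w ! i \<in> avoiding_block (S i) (k i)" if "i < length w" for i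
    using w that unfolding consecutive_words_iff_nth by (simp add: S_def k_def)
  have S_le: "S i + k i \<le> S j" if "i < j" "j \<le> length w" for i j
  proof -
    obtain v where "take j w = take i w @ w ! i # v"
      using id_take_nth_drop[of i "take j w"] \<open>i < j\<close> \<open>j \<le> length w\<close> by auto
    then show ?thesis
      by (simp add: S_def k_def)
  qed
  have inj: "inj_on B K"
  proof (rule linorder_inj_onI')
    fix i j assume "i \<in> K" "j \<in> K" "i < j"
    then have "S i + 1 \<in> B i" "S i + 1 \<notin> B j"
      using S_le[of i j] by (auto simp: B_def K_def)
    then show "B i \<noteq> B j"
      by blast
  qed
  \<comment> \<open>The target sets are indexed by blocks and not by positions in \<open>w\<close>.
    The set for a block collects all words required on it, and injectivity of \<open>B\<close> on
    \<open>K\<close> makes it a singleton.\<close>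
  define A where "A = case_sum (\<lambda>n. {Inl (k (n - 1))}) (\<lambda>I. Inr ` {w ! i | i. i \<in> K \<and> B i = I})"
  define J where "J = Inl ` Suc ` {..<length w} \<union> Inr ` B ` K"
  have mem_Inl: "joint_family X R (Inl (Suc i)) \<omega> \<in> A (Inl (Suc i)) \<longleftrightarrow> X (Suc i) \<omega> = k i" for i \<omega>
    by (auto simp: A_def joint_family_def)
  then have A_Inl: "joint_family X R (Inl (Suc i)) -` A (Inl (Suc i)) \<inter> space M
      = {\<omega> \<in> space M. X (Suc i) \<omega> = k i}" for i
    by blast
  have mem_Inr: "joint_family X R (Inr (B i)) \<omega> \<in> A (Inr (B i)) \<longleftrightarrow> R (B i) \<omega> = w ! i"
    if "i \<in> K" for i \<omega>
  proof -
    have "B j = B i \<longleftrightarrow> j = i" if "j \<in> K" for j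
      using inj that \<open>i \<in> K\<close> by (rule inj_on_eq_iff)
    then have "{j. j \<in> K \<and> B j = B i} = {i}"
      using that by auto
    then have "{w ! j | j. j \<in> K \<and> B j = B i} = {w ! i}"
      by (simp only: setcompr_eq_image image_insert image_empty)
    then have *: "A (Inr (B i)) = {Inr (w ! i)}"
      unfolding A_def sum.case by (simp only: image_insert image_empty)
    show ?thesis
      unfolding * by (auto simp: joint_family_def)
  qed
  then have A_Inr: "joint_family X R (Inr (B i)) -` A (Inr (B i)) \<inter> space M
      = {\<omega> \<in> space M. R (B i) \<omega> = w ! i}" if "i \<in> K" for i
    using that by blast
  have R0: "R (B i) \<omega> = w ! i" if "i < length w" "i \<notin> K" "\<omega> \<in> space M" for i \<omega>
    using that w'[of i] R_block[of \<omega> "S i" 0] by (simp add: K_def B_def)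
  have "{\<omega> \<in> space M. words (length w) \<omega> = w}
      = (\<Inter>j\<in>J. joint_family X R j -` A j \<inter> space M)" (is "?L = ?R")
  proof -
    have "\<omega> \<in> ?R \<longleftrightarrow> \<omega> \<in> space M \<and> (\<forall>i<length w. X (Suc i) \<omega> = k i) \<and> (\<forall>i\<in>K. R (B i) \<omega> = w ! i)" for \<omega>
      unfolding J_def using mem_Inl mem_Inr False by (auto simp: ball_Un)
    moreover have "\<omega> \<in> ?L \<longleftrightarrow> \<omega> \<in> space M \<and> (\<forall>i<length w. X (Suc i) \<omega> = k i \<and> R (B i) \<omega> = w ! i)" for \<omega>
      using words_eq_iff[of \<omega> w] by (auto simp: k_def B_def S_def)
    moreover have "(\<forall>i<length w. X (Suc i) \<omega> = k i) \<and> (\<forall>i\<in>K. R (B i) \<omega> = w ! i)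
        \<longleftrightarrow> (\<forall>i<length w. X (Suc i) \<omega> = k i \<and> R (B i) \<omega> = w ! i)" if "\<omega> \<in> space M" for \<omega>
    proof -
      have "(\<forall>i\<in>K. R (B i) \<omega> = w ! i) \<longleftrightarrow> (\<forall>i<length w. R (B i) \<omega> = w ! i)"
        using R0[OF _ _ that] unfolding K_def by blast
      then show ?thesis
        by blast
    qed
    ultimately show ?thesis
      by (intro set_eqI) (simp only: cong: conj_cong)
  qed
  also have "prob \<dots> = (\<Prod>j\<in>J. prob (joint_family X R j -` A j \<inter> space M))"
    by (rule indep_varsD[OF independent])
      (use False block_in_blocks in \<open>auto simp: J_def B_def\<close>)
  also have "\<dots> = (\<Prod>j\<in>Inl ` Suc ` {..<length w}. prob (joint_family X R j -` A j \<inter> space M))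
      * (\<Prod>j\<in>Inr ` B ` K. prob (joint_family X R j -` A j \<inter> space M))"
    unfolding J_def by (rule prod.union_disjoint) auto
  also have "(\<Prod>j\<in>Inl ` Suc ` {..<length w}. prob (joint_family X R j -` A j \<inter> space M))
      = (\<Prod>i<length w. catalan (k i) / (2 * 4 ^ k i))"
    by (simp add: prod.reindex A_Inl X_distribution)
  also have "(\<Prod>j\<in>Inr ` B ` K. prob (joint_family X R j -` A j \<inter> space M))
      = (\<Prod>i\<in>K. prob (joint_family X R (Inr (B i)) -` A (Inr (B i)) \<inter> space M))"
    using inj by (simp add: prod.reindex)
  also have "\<dots> = (\<Prod>i\<in>K. 1 / catalan (k i))"
  proof (rule prod.cong)
    fix i assume i: "i \<in> K"
    then show "prob (joint_family X R (Inr (B i)) -` A (Inr (B i)) \<inter> space M) = 1 / catalan (k i)"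
      unfolding A_Inr[OF i] unfolding B_def using w'[of i] by (intro R_event) (simp add: K_def)
  qed simp
  also have "\<dots> = (\<Prod>i<length w. 1 / catalan (k i))"
    by (rule prod.mono_neutral_left) (auto simp: K_def)
  also have "(\<Prod>i<length w. catalan (k i) / (2 * 4 ^ k i)) * \<dots> = (\<Prod>i<length w. 1 / (2 * 4 ^ k i))"
    unfolding prod.distrib[symmetric]
    by (intro prod.cong) (auto simp: catalan_pos[THEN less_imp_neq, symmetric])
  also have "\<dots> = word_prob w"
    by (simp add: word_prob_def prod.list_conv_set_nth k_def atLeast0LessThan)
  finally show ?thesis .
qed

section \<open>Almost sure surjectivity\<close>

lemma AE_exists_positive: "AE \<omega> in M. \<exists>n>m. 0 < X n \<omega>"
proof -
  let ?E = "\<lambda>n. {\<omega> \<in> space M. X n \<omega> = 0}"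
  define F where "F = {\<omega> \<in> space M. \<forall>n>m. X n \<omega> = 0}"
  have "{\<omega> \<in> space M. X (m + Suc i) \<omega> = 0} \<in> events" for i
    by (intro X_event) simp
  moreover have "F = (\<Inter>i. {\<omega> \<in> space M. X (m + Suc i) \<omega> = 0})"
    by (auto simp: F_def) (metis less_iff_Suc_add add_Suc_right)
  ultimately have F: "F \<in> events"
    by (auto intro!: sets.countable_INT')
  \<comment> \<open>On \<open>F\<close> the next \<open>r\<close> variables vanish; they are
    independent and each is 0 with probability \<open>catalan 0 / 2 = 1/2\<close>. The product rule
    requires a nonempty index set, hence \<open>0 < r\<close>.\<close>
  have "prob F \<le> (1/2) ^ r" if "0 < r" for r
  proof -
    let ?J = "Inl ` {m<..m + r} :: (nat + nat set) set"
    have eq: "joint_family X R (Inl n) -` {Inl 0} \<inter> space M = ?E n" for n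
      by (auto simp: joint_family_def)
    have "F \<subseteq> (\<Inter>j\<in>?J. joint_family X R j -` {Inl 0} \<inter> space M)"
      by (auto simp: F_def joint_family_def)
    moreover have "(\<Inter>j\<in>?J. joint_family X R j -` {Inl 0} \<inter> space M) = (\<Inter>n\<in>{m<..m + r}. ?E n)"
      by (simp only: image_image eq)
    moreover have "(\<Inter>n\<in>{m<..m + r}. ?E n) \<in> events"
      using that by (intro sets.finite_INT X_event) auto
    ultimately have "prob F \<le> prob (\<Inter>j\<in>?J. joint_family X R j -` {Inl 0} \<inter> space M)"
      by (intro finite_measure_mono) auto
    also have "\<dots> = (\<Prod>j\<in>?J. prob (joint_family X R j -` {Inl 0} \<inter> space M))"
      by (rule indep_varsD[OF independent]) (use that in auto)
    also have "\<dots> = (\<Prod>n\<in>{m<..m + r}. prob (?E n))"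
      by (simp add: prod.reindex eq)
    also have "\<dots> = (\<Prod>n\<in>{m<..m + r}. 1/2)"
      by (intro prod.cong) (auto simp: X_distribution)
    finally show ?thesis
      by simp
  qed
  moreover have "(\<lambda>r. (1/2::real) ^ r) \<longlonglongrightarrow> 0"
    by (intro LIMSEQ_power_zero) simp
  ultimately have "prob F \<le> 0"
    by (intro LIMSEQ_le_const[of "\<lambda>r. (1/2) ^ r"]) (auto intro!: exI[of _ 1])
  then have "prob F = 0"
    using measure_nonneg[of M F] by linarith
  then have "AE \<omega> in M. \<omega> \<notin> F"
    using F by (intro AE_not_in null_setsI) (simp add: emeasure_eq_measure)
  then show ?thesis
    using AE_space by eventually_elim (auto simp: F_def)
qed

text \<open>Infinitely many positive lengths make the partial sums unbounded, so every positive
  integer falls into some block; \<open>\<infinity>\<close> is already supplied by the end of the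
  first one.\<close>

lemma AE_surjective: "AE \<omega> in M. random_concat X R \<omega> \<in> sur_seq_space"
proof -
  have "AE \<omega> in M. \<forall>m. \<exists>n>m. 0 < X n \<omega>"
    unfolding AE_all_countable using AE_exists_positive by blast
  then show ?thesis
  proof (rule AE_mp, intro AE_I2 impI)
    fix \<omega> assume \<omega>: "\<omega> \<in> space M" and pos: "\<forall>m. \<exists>n>m. 0 < X n \<omega>"
    let ?\<sigma> = "random_concat X R \<omega>"
    have mono: "partial_sum X i \<omega> \<le> partial_sum X j \<omega>" if "i \<le> j" for i j
      using that by (rule lift_Suc_mono_le[rotated]) simp
    have large: "\<exists>m. n \<le> partial_sum X m \<omega>" for n
    proof (induction n)
      case (Suc n)
      then obtain m where "n \<le> partial_sum X m \<omega>"
        by blast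
      moreover obtain j where "m < j" "0 < X j \<omega>"
        using pos by blast
      moreover have "partial_sum X m \<omega> \<le> partial_sum X (j - 1) \<omega>"
        using \<open>m < j\<close> by (intro mono) simp
      moreover have "partial_sum X j \<omega> = partial_sum X (j - 1) \<omega> + X j \<omega>"
        using \<open>m < j\<close> partial_sum_Suc[of "j - 1" \<omega>] by simp
      ultimately have "Suc n \<le> partial_sum X j \<omega>"
        by linarith
      then show ?case
        by blast
    qed simp
    have in_range: "x \<in> ?\<sigma> ` {1..}" if "x \<in> set (with_infinities (words m \<omega>))" for x m
    proof -
      have "x \<in> set (map ?\<sigma> [1..<Suc (length (with_infinities (words m \<omega>)))])"
        using that by (simp only: random_concat_prefix)
      then show ?thesis
        by (auto simp del: upt_Suc)
    qed
    have "Nstar \<subseteq> ?\<sigma> ` {1..}"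
    proof
      fix x assume x: "x \<in> Nstar"
      show "x \<in> ?\<sigma> ` {1..}"
      proof (cases x)
        case (enat n)
        then have "1 \<le> n"
          using x by (simp add: Nstar_def one_enat_def)
        obtain m where "n \<le> partial_sum X m \<omega>"
          using large by blast
        then have "n \<in> set (concat (words m \<omega>))"
          using concat_words[OF \<omega>, of m] \<open>1 \<le> n\<close> by (simp add: mem_avoiding_block del: set_concat)
        then show ?thesis
          using enat by (intro in_range[of _ m]) (simp add: set_with_infinities del: set_concat)
      next
        case infinity
        then show ?thesis
          by (intro in_range[of _ 1]) (auto simp: set_with_infinities words_def)
      qed
    qed
    then show "?\<sigma> \<in> sur_seq_space"
      using random_concat_in_seq_space[OF \<omega>] by (auto simp: sur_seq_space_def seq_space_def)
  qed
qed

end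


section \<open>Weak convergence\<close>

context random_words
begin

text \<open>This is the best lower bound for \<open>f\<close> that the first \<open>m\<close> words
  provide when every \<open>\<infinity>\<close> is only known as a value of at least
  \<open>m\<close>; such information is also available for permutations.\<close>

definition cylinder_inf :: "((nat \<Rightarrow> enat) \<Rightarrow> real) \<Rightarrow> nat \<Rightarrow> nat list list \<Rightarrow> real" where
  "cylinder_inf f m w = Inf (f ` cylinder m (with_infinities w))"

lemma cylinder_inf_le:
  assumes "\<And>\<sigma>. \<sigma> \<in> seq_space \<Longrightarrow> 0 \<le> f \<sigma>" "\<sigma> \<in> cylinder m (with_infinities w)"
  shows "cylinder_inf f m w \<le> f \<sigma>"
  unfolding cylinder_inf_def
  using assms by (intro cInf_lower bdd_belowI2[of _ 0]) (auto simp: cylinder_def)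

text \<open>The random sequence itself witnesses that the cylinder is nonempty; without this the
  infimum would be an unspecified value.\<close>

lemma cylinder_inf_words_nonneg:
  assumes "\<And>\<sigma>. \<sigma> \<in> seq_space \<Longrightarrow> 0 \<le> f \<sigma>" "\<omega> \<in> space M"
  shows "0 \<le> cylinder_inf f m (words m \<omega>)"
  unfolding cylinder_inf_def
  using assms random_concat_in_cylinder[OF assms(2), of m m]
  by (intro cInf_greatest) (auto simp: cylinder_def)

lemma cylinder_inf_tendsto:
  assumes f: "continuous_map seq_topology euclideanreal f"
    and nonneg: "\<And>\<sigma>. \<sigma> \<in> seq_space \<Longrightarrow> 0 \<le> f \<sigma>" and \<omega>: "\<omega> \<in> space M"
  shows "(\<lambda>m. cylinder_inf f m (words m \<omega>)) \<longlonglongrightarrow> f (random_concat X R \<omega>)"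
proof (rule tendstoI)
  fix e :: real assume "0 < e"
  let ?\<sigma> = "random_concat X R \<omega>"
  \<comment> \<open>Half of \<open>e\<close> is kept back because passing to the infimum weakens
    \<open><\<close> to \<open>\<le>\<close>.\<close>
  let ?U = "{\<sigma> \<in> topspace seq_topology. f \<sigma> \<in> {f ?\<sigma> - e / 2<..}}"
  have "openin seq_topology ?U"
    using f by (rule openin_continuous_map_preimage) simp
  moreover have "?\<sigma> \<in> ?U"
    using \<open>0 < e\<close> random_concat_in_seq_space[OF \<omega>] by (simp add: topspace_seq_topology)
  ultimately have "eventually (\<lambda>m. cylinder m (with_infinities (words m \<omega>)) \<subseteq> ?U) sequentially"
    by (rule eventually_cylinder_words_subset)
  then show "eventually (\<lambda>m. dist (cylinder_inf f m (words m \<omega>)) (f ?\<sigma>) < e) sequentially"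
  proof eventually_elim
    case (elim m)
    have \<sigma>: "?\<sigma> \<in> cylinder m (with_infinities (words m \<omega>))"
      by (rule random_concat_in_cylinder[OF \<omega>])
    then have "f ?\<sigma> - e / 2 \<le> cylinder_inf f m (words m \<omega>)"
      unfolding cylinder_inf_def using elim by (intro cInf_greatest) (auto intro: less_imp_le)
    moreover have "cylinder_inf f m (words m \<omega>) \<le> f ?\<sigma>"
      using nonneg \<sigma> by (rule cylinder_inf_le)
    ultimately show ?case
      using \<open>0 < e\<close> by (simp add: dist_real_def)
  qed
qed

text \<open>Dominated convergence is used twice: first \<open>f\<close> is replaced by its infimum
  over the cylinder of the first \<open>m\<close> words, then all but finitely many lists of words
  are discarded according to their code \<open>to_nat\<close>. A finite sum of word probabilities
  remains.\<close>

lemma finite_approximation: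
  assumes f: "continuous_map seq_topology euclideanreal f"
    and nonneg: "\<And>\<sigma>. \<sigma> \<in> seq_space \<Longrightarrow> 0 \<le> f \<sigma>" and bound: "\<And>\<sigma>. \<sigma> \<in> seq_space \<Longrightarrow> f \<sigma> \<le> B"
    and c: "c < (\<integral>\<omega>. f (random_concat X R \<omega>) \<partial>M)"
  obtains m V where "finite V" "\<And>w. w \<in> V \<Longrightarrow> length w = m \<and> consecutive_words 0 w \<and> 0 \<le> cylinder_inf f m w"
    "c < (\<Sum>w\<in>V. cylinder_inf f m w * word_prob w)"
proof -
  let ?h = "\<lambda>m \<omega>. cylinder_inf f m (words m \<omega>)"
  have f_meas: "(\<lambda>\<omega>. f (random_concat X R \<omega>)) \<in> borel_measurable M"
    by (rule measurable_compose[OF random_concat_measurable continuous_map_borel_measurable[OF f]])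
  have h_meas: "?h m \<in> borel_measurable M" for m
    by (rule measurable_compose[OF words_measurable]) simp
  have h_bound: "norm (?h m \<omega>) \<le> B" if "\<omega> \<in> space M" for m \<omega>
  proof -
    have "?h m \<omega> \<le> f (random_concat X R \<omega>)"
      using nonneg random_concat_in_cylinder[OF that] by (rule cylinder_inf_le)
    moreover have "0 \<le> ?h m \<omega>"
      using nonneg that by (rule cylinder_inf_words_nonneg)
    moreover have "f (random_concat X R \<omega>) \<le> B"
      using random_concat_in_seq_space[OF that] by (rule bound)
    ultimately show ?thesis
      by simp
  qed
  have "(\<lambda>m. \<integral>\<omega>. ?h m \<omega> \<partial>M) \<longlonglongrightarrow> (\<integral>\<omega>. f (random_concat X R \<omega>) \<partial>M)"
    by (rule integral_dominated_convergence[where w = "\<lambda>_. B"])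
      (use f_meas h_meas h_bound cylinder_inf_tendsto[OF f nonneg] in \<open>auto intro!: AE_I2\<close>)
  then have "eventually (\<lambda>m. c < (\<integral>\<omega>. ?h m \<omega> \<partial>M)) sequentially"
    using c by (rule order_tendstoD)
  then obtain m where m: "c < (\<integral>\<omega>. ?h m \<omega> \<partial>M)"
    by (auto simp: eventually_sequentially)
  let ?g = "\<lambda>r \<omega>. ?h m \<omega> * indicator {w. to_nat w < r} (words m \<omega>)"
  have "(\<lambda>r. \<integral>\<omega>. ?g r \<omega> \<partial>M) \<longlonglongrightarrow> (\<integral>\<omega>. ?h m \<omega> \<partial>M)"
  proof (rule integral_dominated_convergence[where w = "\<lambda>_. B"])
    show "?g r \<in> borel_measurable M" for r
      by (rule measurable_compose[OF words_measurable]) simp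
    have "norm (?g r \<omega>) \<le> B" if "\<omega> \<in> space M" for r \<omega>
      using h_bound[OF that, of m] by (auto simp: indicator_def)
    then show "AE \<omega> in M. norm (?g r \<omega>) \<le> B" for r
      by (intro AE_I2)
    have "(\<lambda>r. ?g r \<omega>) \<longlonglongrightarrow> ?h m \<omega>" for \<omega>
    proof (rule tendsto_eventually)
      show "eventually (\<lambda>r. ?g r \<omega> = ?h m \<omega>) sequentially"
        using eventually_gt_at_top[of "to_nat (words m \<omega>)"]
        by eventually_elim (simp add: indicator_def)
    qed
    then show "AE \<omega> in M. (\<lambda>r. ?g r \<omega>) \<longlonglongrightarrow> ?h m \<omega>"
      by simp
  qed (use h_meas in auto)
  then have "eventually (\<lambda>r. c < (\<integral>\<omega>. ?g r \<omega> \<partial>M)) sequentially"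
    using m by (rule order_tendstoD)
  then obtain r where r: "c < (\<integral>\<omega>. ?g r \<omega> \<partial>M)"
    by (auto simp: eventually_sequentially)
  \<comment> \<open>Intersecting with the values of \<open>words m\<close> leaves only lists on
    consecutive blocks, for which the infimum is known to be nonnegative.\<close>
  define V where "V = {w. to_nat w < r} \<inter> words m ` space M"
  have "finite {w :: nat list list. to_nat w < r}"
    using finite_vimageI[of "{..<r}" to_nat] by (simp add: vimage_def)
  then have fin: "finite V"
    by (simp add: V_def)
  have V: "length w = m \<and> consecutive_words 0 w \<and> 0 \<le> cylinder_inf f m w" if "w \<in> V" for w
    using that consecutive_words_words cylinder_inf_words_nonneg[OF nonneg] by (auto simp: V_def)
  have "(\<integral>\<omega>. ?g r \<omega> \<partial>M)
      = (\<integral>\<omega>. (\<Sum>w\<in>V. cylinder_inf f m w * indicator {\<omega> \<in> space M. words m \<omega> = w} \<omega>) \<partial>M)"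
  proof (rule Bochner_Integration.integral_cong)
    fix \<omega> assume \<omega>: "\<omega> \<in> space M"
    have "(\<Sum>w\<in>V. cylinder_inf f m w * indicator {\<omega> \<in> space M. words m \<omega> = w} \<omega>)
        = (\<Sum>w\<in>V. if w = words m \<omega> then cylinder_inf f m w else 0)"
      using \<omega> by (intro sum.cong) (auto simp: indicator_def)
    also have "\<dots> = ?g r \<omega>"
      using fin \<omega> by (auto simp: V_def)
    finally show "?g r \<omega> = (\<Sum>w\<in>V. cylinder_inf f m w * indicator {\<omega> \<in> space M. words m \<omega> = w} \<omega>)"
      by simp
  qed simp
  also have "\<dots> = (\<Sum>w\<in>V. cylinder_inf f m w * prob {\<omega> \<in> space M. words m \<omega> = w})"
    by (subst Bochner_Integration.integral_sum)
      (auto intro!: integrable_mult_right integrable_real_indicator words_event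
        simp: emeasure_eq_measure words_event)
  also have "\<dots> = (\<Sum>w\<in>V. cylinder_inf f m w * word_prob w)"
    using V prob_words by (intro sum.cong) auto
  finally show thesis
    using fin V r by (intro that[of V m]) auto
qed

text \<open>As the cylinders of distinct words are disjoint, lower bounds for their probabilities
  suffice.\<close>

lemma eventually_integral_uniform_avoiding_gt:
  assumes f: "continuous_map seq_topology euclideanreal f"
    and nonneg: "\<And>\<sigma>. \<sigma> \<in> seq_space \<Longrightarrow> 0 \<le> f \<sigma>" and bound: "\<And>\<sigma>. \<sigma> \<in> seq_space \<Longrightarrow> f \<sigma> \<le> B"
    and c: "c < (\<integral>\<omega>. f (random_concat X R \<omega>) \<partial>M)"
  shows "eventually (\<lambda>n. c < (\<integral>\<sigma>. f \<sigma> \<partial>uniform_avoiding [2,3,1] n)) sequentially"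
proof -
  obtain m V where fin: "finite V"
    and V: "\<And>w. w \<in> V \<Longrightarrow> length w = m \<and> consecutive_words 0 w \<and> 0 \<le> cylinder_inf f m w"
    and c': "c < (\<Sum>w\<in>V. cylinder_inf f m w * word_prob w)"
    using finite_approximation[OF f nonneg bound c] by metis
  \<comment> \<open>A common factor \<open>t\<close> slightly below 1 creates the strict slack that
    \<open>eventually_card_matching_words\<close> needs for every \<open>w\<close>.\<close>
  have "((\<lambda>t. \<Sum>w\<in>V. cylinder_inf f m w * (t * word_prob w))
      \<longlongrightarrow> (\<Sum>w\<in>V. cylinder_inf f m w * (1 * word_prob w))) (at_left 1)"
    by (intro tendsto_intros)
  then have "eventually (\<lambda>t. c < (\<Sum>w\<in>V. cylinder_inf f m w * (t * word_prob w))) (at_left 1)"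
    by (rule order_tendstoD) (simp add: c')
  moreover have "eventually (\<lambda>t::real. t < 1) (at_left 1)"
    by (simp add: eventually_at_filter)
  ultimately have "eventually (\<lambda>t. c < (\<Sum>w\<in>V. cylinder_inf f m w * (t * word_prob w)) \<and> t < 1) (at_left 1)"
    by (rule eventually_conj)
  then obtain t where t: "c < (\<Sum>w\<in>V. cylinder_inf f m w * (t * word_prob w))" "t < 1"
    using eventually_happens'[of "at_left (1::real)"] by auto
  have "finite (\<Union>w\<in>V. \<Union>l\<in>set w. set l)"
    using fin by auto
  then obtain N0 where N0: "\<forall>x\<in>(\<Union>w\<in>V. \<Union>l\<in>set w. set l). x < N0"
    by (auto simp: finite_nat_set_iff_bounded)
  \<comment> \<open>From \<open>m \<le> N\<close> the new cylinders lie inside those that define the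
    infima; as \<open>N\<close> also exceeds all entries, cylinders of distinct lists are
    disjoint.\<close>
  define N where "N = max m N0"
  have "eventually (\<lambda>n. \<forall>w\<in>V. t * word_prob w * catalan n \<le> real (card (matching_words N w 0 n)))
      sequentially"
  proof (intro eventually_ball_finite fin ballI eventually_card_matching_words catalan_sums)
    show "consecutive_words 0 w" "t * word_prob w < word_prob w" if "w \<in> V" for w
      using V[OF that] t word_prob_pos[of w] by auto
  qed
  then show ?thesis
  proof eventually_elim
    case (elim n)
    let ?A = "avoiding_perms [2,3,1] n"
    let ?C = "\<lambda>w. {p \<in> ?A. perm_to_seq p \<in> cylinder N (with_infinities w)}"
    have in_space: "perm_to_seq p \<in> seq_space" if "p \<in> ?A" for p
      using that perm_to_seq_in_seq_space by (auto simp: avoiding_perms_def)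
    have finC: "finite (?C w)" for w
      by (rule finite_subset[OF _ finite_avoiding_perms[of n]]) blast
    have "?C w \<inter> ?C w' = {}" if "w \<in> V" "w' \<in> V" "w \<noteq> w'" for w w'
    proof -
      have "length w = length w'" "\<forall>l\<in>set w \<union> set w'. \<forall>x\<in>set l. x < N"
        using V[OF that(1)] V[OF that(2)] N0 that by (auto simp: N_def less_max_iff_disj)
      then show ?thesis
        using cylinder_with_infinities_disjoint[of w w' _ N] that(3) by blast
    qed
    then have "(\<Sum>w\<in>V. \<Sum>p\<in>?C w. f (perm_to_seq p)) = (\<Sum>p\<in>(\<Union>w\<in>V. ?C w). f (perm_to_seq p))"
      using fin finC by (intro sum.UNION_disjoint[symmetric]) auto
    also have "\<dots> \<le> (\<Sum>p\<in>?A. f (perm_to_seq p))"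
      using nonneg in_space finite_avoiding_perms[of n] by (intro sum_mono2) auto
    finally have le: "(\<Sum>w\<in>V. \<Sum>p\<in>?C w. f (perm_to_seq p)) \<le> (\<Sum>p\<in>?A. f (perm_to_seq p))" .
    have "c * catalan n < (\<Sum>w\<in>V. cylinder_inf f m w * (t * word_prob w)) * catalan n"
      using t(1) catalan_pos by (rule mult_strict_right_mono)
    also have "\<dots> = (\<Sum>w\<in>V. cylinder_inf f m w * (t * word_prob w * catalan n))"
      by (simp add: sum_distrib_right mult.assoc)
    also have "\<dots> \<le> (\<Sum>w\<in>V. \<Sum>p\<in>?C w. f (perm_to_seq p))"
    proof (rule sum_mono)
      fix w assume w: "w \<in> V"
      have "t * word_prob w * catalan n \<le> real (card (matching_words N w 0 n))"
        using elim w by blast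
      also have "\<dots> \<le> real (card (?C w))"
        by (rule of_nat_mono[OF card_matching_words_le])
      finally have "cylinder_inf f m w * (t * word_prob w * catalan n) \<le> cylinder_inf f m w * real (card (?C w))"
        using V[OF w] by (intro mult_left_mono) auto
      also have "\<dots> = (\<Sum>p\<in>?C w. cylinder_inf f m w)"
        by simp
      also have "\<dots> \<le> (\<Sum>p\<in>?C w. f (perm_to_seq p))"
        using cylinder_antimono[of m N "with_infinities w"]
        by (intro sum_mono cylinder_inf_le nonneg) (auto simp: N_def)
      finally show "cylinder_inf f m w * (t * word_prob w * catalan n) \<le> (\<Sum>p\<in>?C w. f (perm_to_seq p))" .
    qed
    also note le
    finally show ?case
      unfolding integral_uniform_avoiding[OF continuous_map_borel_measurable[OF f]]
      using catalan_pos[of n] by (simp add: field_simps)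
  qed
qed

text \<open>The lower bound is applied to the nonnegative functions \<open>B + f\<close> and
  \<open>B - f\<close>, that is, with \<open>s = 1\<close> and \<open>s = -1\<close>. All measures
  have mass 1, so the constant drops out, and the two bounds enclose the integrals from both
  sides.\<close>

lemma integral_uniform_avoiding_tendsto:
  assumes f: "continuous_map seq_topology euclideanreal f"
    and bound: "\<And>\<sigma>. \<sigma> \<in> seq_space \<Longrightarrow> \<bar>f \<sigma>\<bar> \<le> B"
  shows "(\<lambda>n. \<integral>\<sigma>. f \<sigma> \<partial>uniform_avoiding [2,3,1] n) \<longlonglongrightarrow> (\<integral>\<omega>. f (random_concat X R \<omega>) \<partial>M)"
proof -
  have f_meas: "f \<in> borel_measurable (borel_sigma seq_topology)"
    using f by (rule continuous_map_borel_measurable)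
  have integrable: "integrable \<mu> f" and prob: "prob_space \<mu>"
    if "\<mu> \<in> prob_measures_on seq_topology" for \<mu>
  proof -
    have \<mu>: "prob_space \<mu>" "sets \<mu> = sets (borel_sigma seq_topology)"
      using that by (auto simp: prob_measures_on_def)
    interpret \<mu>: prob_space \<mu> by (rule \<mu>)
    show "prob_space \<mu>" by (rule \<mu>)
    show "integrable \<mu> f"
    proof (rule \<mu>.integrable_const_bound[of _ B])
      show "AE \<sigma> in \<mu>. norm (f \<sigma>) \<le> B"
        using bound sets_eq_imp_space_eq[OF \<mu>(2)] by (intro AE_I2) auto
      show "f \<in> borel_measurable \<mu>"
        using f_meas measurable_cong_sets[OF \<mu>(2) refl] by blast
    qed
  qed
  let ?\<nu> = "distr M (borel_sigma seq_topology) (random_concat X R)"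
  have \<nu>: "?\<nu> \<in> prob_measures_on seq_topology"
    by (simp add: prob_measures_on_def prob_space_distr random_concat_measurable)
  have transfer: "(\<integral>\<sigma>. g \<sigma> \<partial>?\<nu>) = (\<integral>\<omega>. g (random_concat X R \<omega>) \<partial>M)"
    if "g \<in> borel_measurable (borel_sigma seq_topology)" for g :: "(nat \<Rightarrow> enat) \<Rightarrow> real"
    using that by (rule integral_distr[OF random_concat_measurable])
  have shift: "(\<integral>\<sigma>. B + s * f \<sigma> \<partial>\<mu>) = B + s * (\<integral>\<sigma>. f \<sigma> \<partial>\<mu>)"
    if "\<mu> \<in> prob_measures_on seq_topology" for \<mu> s
    using integrable[OF that] prob_space.prob_space[OF prob[OF that]]
      prob_space.finite_measure[OF prob[OF that], THEN finite_measure.integrable_const]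
    by (subst Bochner_Integration.integral_add) auto
  have lower: "eventually (\<lambda>n. s * (\<integral>\<sigma>. f \<sigma> \<partial>?\<nu>) - e < s * (\<integral>\<sigma>. f \<sigma> \<partial>uniform_avoiding [2,3,1] n)) sequentially"
    if "0 < e" "\<bar>s\<bar> = 1" for e s :: real
  proof -
    have cont: "continuous_map seq_topology euclideanreal (\<lambda>\<sigma>. B + s * f \<sigma>)"
      using f by (intro continuous_intros)
    have "\<bar>s * f \<sigma>\<bar> \<le> B" if "\<sigma> \<in> seq_space" for \<sigma>
      using bound[OF that] \<open>\<bar>s\<bar> = 1\<close> by (simp add: abs_mult)
    then have "0 \<le> B + s * f \<sigma>" "B + s * f \<sigma> \<le> 2 * B" if "\<sigma> \<in> seq_space" for \<sigma>
      using that by (fastforce simp: abs_le_iff)+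
    moreover have "(\<integral>\<omega>. B + s * f (random_concat X R \<omega>) \<partial>M) = B + s * (\<integral>\<sigma>. f \<sigma> \<partial>?\<nu>)"
      using transfer[OF continuous_map_borel_measurable[OF cont]] shift[OF \<nu>, of s] by simp
    then have "B + s * (\<integral>\<sigma>. f \<sigma> \<partial>?\<nu>) - e < (\<integral>\<omega>. B + s * f (random_concat X R \<omega>) \<partial>M)"
      using \<open>0 < e\<close> by simp
    ultimately have "eventually (\<lambda>n. B + s * (\<integral>\<sigma>. f \<sigma> \<partial>?\<nu>) - e
        < (\<integral>\<sigma>. B + s * f \<sigma> \<partial>uniform_avoiding [2,3,1] n)) sequentially"
      by (rule eventually_integral_uniform_avoiding_gt[OF cont])
    then show ?thesis
      by (simp add: shift uniform_avoiding_in_prob_measures_on del: One_nat_def)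
  qed
  have "(\<lambda>n. \<integral>\<sigma>. f \<sigma> \<partial>uniform_avoiding [2,3,1] n) \<longlonglongrightarrow> (\<integral>\<sigma>. f \<sigma> \<partial>?\<nu>)"
  proof (rule tendstoI)
    fix e :: real assume "0 < e"
    show "eventually (\<lambda>n. dist (\<integral>\<sigma>. f \<sigma> \<partial>uniform_avoiding [2,3,1] n) (\<integral>\<sigma>. f \<sigma> \<partial>?\<nu>) < e) sequentially"
      using lower[OF \<open>0 < e\<close>, of 1, simplified] lower[OF \<open>0 < e\<close>, of "-1", simplified]
      by eventually_elim (auto simp: dist_real_def abs_less_iff)
  qed
  then show ?thesis
    by (simp add: transfer f_meas)
qed

end

theorem theorem2:
  fixes M :: "'w measure"
    and X :: "nat \<Rightarrow> 'w \<Rightarrow> nat"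
    and R :: "nat set \<Rightarrow> 'w \<Rightarrow> nat list"
  assumes "prob_space M"
    and X_measurable: "\<And>n. n \<ge> 1 \<Longrightarrow> X n \<in> measurable M (count_space UNIV)"
    and X_distribution:
      "\<And>n k. n \<ge> 1 \<Longrightarrow> measure M {\<omega> \<in> space M. X n \<omega> = k} = catalan k / (2 * 4 ^ k)"
    and R_measurable:
      "\<And>I. I \<in> blocks \<Longrightarrow> R I \<in> measurable M (count_space (avoiding_images [2,3,1] I))"
    and R_uniform:
      "\<And>I. I \<in> blocks \<Longrightarrow> distr M (count_space (avoiding_images [2,3,1] I)) (R I)
                            = uniform_count_measure (avoiding_images [2,3,1] I)"
    and independent:
      "prob_space.indep_vars M (\<lambda>_. count_space UNIV) (joint_family X R)
         (Inl ` {1..} \<union> Inr ` blocks)"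
  shows "random_concat X R \<in> measurable M (borel_sigma seq_topology)
    \<and> (AE \<omega> in M. random_concat X R \<omega> \<in> sur_seq_space)
    \<and> converges_weakly seq_topology (uniform_avoiding [2,3,1])
        (distr M (borel_sigma seq_topology) (random_concat X R))"
proof -
  interpret prob_space M
    by fact
  interpret random_words M X R
    by unfold_locales (fact assms)+
  have "converges_weakly seq_topology (uniform_avoiding [2,3,1])
      (distr M (borel_sigma seq_topology) (random_concat X R))"
    unfolding converges_weakly_def
  proof (intro conjI allI impI)
    show "uniform_avoiding [2,3,1] n \<in> prob_measures_on seq_topology" for n
      by (rule uniform_avoiding_in_prob_measures_on)
    show "distr M (borel_sigma seq_topology) (random_concat X R) \<in> prob_measures_on seq_topology"
      by (simp add: prob_measures_on_def prob_space_distr random_concat_measurable)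
    fix f :: "(nat \<Rightarrow> enat) \<Rightarrow> real"
    assume f: "continuous_map seq_topology euclideanreal f \<and> bounded (f ` topspace seq_topology)"
    then obtain B where "\<And>\<sigma>. \<sigma> \<in> seq_space \<Longrightarrow> \<bar>f \<sigma>\<bar> \<le> B"
      by (auto simp: bounded_iff topspace_seq_topology)
    with f have "(\<lambda>n. \<integral>\<sigma>. f \<sigma> \<partial>uniform_avoiding [2,3,1] n)
        \<longlonglongrightarrow> (\<integral>\<omega>. f (random_concat X R \<omega>) \<partial>M)"
      by (intro integral_uniform_avoiding_tendsto) auto
    then show "(\<lambda>n. \<integral>\<sigma>. f \<sigma> \<partial>uniform_avoiding [2,3,1] n)
        \<longlonglongrightarrow> (\<integral>\<sigma>. f \<sigma> \<partial>distr M (borel_sigma seq_topology) (random_concat X R))"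
      using f by (simp add: integral_distr[OF random_concat_measurable] continuous_map_borel_measurable)
  qed
  then show ?thesis
    using random_concat_measurable AE_surjective by blast
qed

end
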